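(* Let $P$ be a polytope of dimension $l$ and $Q$ a polytope of dimension $n-1$. Let $m$ be a positive integer with $m\le n$. Given a triangulation $T_0$ of $P\times\Delta^{m-1}$ of weighted size $t_0$ and a triangulation $T_Q$ of $Q$, there are triangulations of $P\times Q$ with size at most $$|T_Q|\,t_0\left(\frac{n}{m}+l\right)^l .$$
   Context: A triangulation of a $d$-dimensional polytope is a decomposition of it into $d$-simplices that use as vertices only vertices of the polytope and that intersect face to face (i.e., they form a geometric simplicial complex). The size $|T|$ of a triangulation $T$ is its number of $d$-simplices. $\Delta^{m-1}$ denotes a simplex of dimension $m-1$, with vertices $v_1,\dots,v_m$. Simplices are identified with their vertex sets. Let $P$ be a polytope of dimension $l$ and let $\tau$ be an $(l+m-1)$-dimensional simplex whose vertices are vertices of $P\times\Delta^{m-1}$. As a vertex set, $\tau=\tau_1\cup\dots\cup\tau_m$ with $\tau_i\subset P\times\{v_i\}$. The type of $\tau$ is $(t_1,\dots,t_m)=(|\tau_1|-1,\dots,|\tau_m|-1)$ and its weight is $\operatorname{weight}(\tau)=\frac{1}{\prod_{i=1}^m t_i!}$. The weighted size of a triangulation $T$ of $P\times\Delta^{m-1}$ is $\sum_{\tau\in T}\operatorname{weight}(\tau)$, the sum being over the full-dimensional simplices of $T$. *)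

theory Defs
  imports "HOL-Analysis.Analysis"
begin

definition vertices :: "'a::euclidean_space set \<Rightarrow> 'a set" where
  "vertices P = {x. x extreme_point_of P}"

text \<open>
  Triangulations are represented by the set of their full-dimensional simplices, as convex
  sets; the vertex set of a simplex is recovered by \<^const>\<open>vertices\<close>, and the size of \<open>T\<close> is
  \<open>card T\<close>. The library predicate \<^const>\<open>triangulation\<close> gives finiteness and the condition that
  any two simplices meet in a common (possibly empty) face.
\<close>

definition triangulation_of :: "'a::euclidean_space set set \<Rightarrow> 'a set \<Rightarrow> bool" where
  "triangulation_of T P \<longleftrightarrow>
     triangulation T \<and> \<Union>T = P \<and>
     (\<forall>S\<in>T. (aff_dim P) simplex S \<and> vertices S \<subseteq> vertices P)"

text \<open>
  For a simplex \<open>S\<close> in \<open>P \<times> D\<close>, with \<open>D\<close> a simplex, the entries of the type of \<open>S\<close> are indexed by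
  the vertices \<open>v\<close> of \<open>D\<close>. If \<open>S\<close> is full-dimensional in \<open>P \<times> D\<close>, it has a vertex
  in every \<open>P \<times> {v}\<close>, so the natural number subtraction does not truncate.
\<close>

definition simplex_type ::
  "('a::euclidean_space \<times> 'c::euclidean_space) set \<Rightarrow> 'c \<Rightarrow> nat" where
  "simplex_type S v = card {x \<in> vertices S. snd x = v} - 1"

definition weight ::
  "'c::euclidean_space set \<Rightarrow> ('a::euclidean_space \<times> 'c) set \<Rightarrow> real" where
  "weight D S = 1 / (\<Prod>v\<in>vertices D. fact (simplex_type S v))"

definition weighted_size ::
  "'c::euclidean_space set \<Rightarrow> ('a::euclidean_space \<times> 'c) set set \<Rightarrow> real" where
  "weighted_size D T = (\<Sum>S\<in>T. weight D S)"

end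

theory Submission
  imports Defs
begin

text \<open>
  Colour the vertices of \<open>Q\<close> with the vertices of \<open>D\<close>, by a map \<open>c\<close>. Extended affinely to
  the simplices of \<open>TQ\<close>, \<open>c\<close> maps \<open>Q\<close> to \<open>D\<close>, and the preimages of the simplices of \<open>T0\<close>
  in the products \<open>P \<times> S\<close> with \<open>S \<in> TQ\<close> subdivide \<open>P \<times> Q\<close>. Such a preimage is spanned by
  the vertices \<open>(x, w)\<close> with \<open>(x, c w)\<close> a vertex of a simplex \<open>R \<in> T0\<close> and \<open>w\<close> a vertex
  of \<open>S\<close>. Choosing in each colour class a monotone staircase, for fixed orders of the vertices of
  \<open>P\<close> and \<open>Q\<close>, refines the subdivision to a triangulation. A point of \<open>P \<times> Q\<close> determines its
  barycentric coordinates: its image in \<open>Q\<close> gives one marginal, its image in \<open>P \<times> D\<close> the other,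
  and a coupling with noncrossing support is determined by its marginals (northwest corner rule).

  If \<open>R\<close> has type \<open>t\<close> and \<open>S\<close> has \<open>n v\<close> vertices of colour \<open>v\<close>, there are at most
  \<open>weight D R * (\<Prod>v. n v * (n v + 1) * \<dots> * (n v + t v - 1))\<close> simplices for \<open>R\<close> and \<open>S\<close>.
  No colouring need be balanced on every \<open>S\<close> at once, but for a uniformly random
  one the expectation of the product is at most \<open>\<Prod>v. (n / m + t v - 1) ^ t v \<le> (n / m + l) ^ l\<close>,
  so some colouring satisfies the bound.
\<close>

section \<open>Random colourings\<close>

lemma sum_PiE_insert:
  fixes h :: "('w \<Rightarrow> 'i) \<Rightarrow> real"
  assumes "v \<notin> W"
  shows "(\<Sum>c\<in>insert v W \<rightarrow>\<^sub>E C. h c) = (\<Sum>y\<in>C. \<Sum>c\<in>W \<rightarrow>\<^sub>E C. h (c(v := y)))"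
proof -
  have "(\<Sum>c\<in>insert v W \<rightarrow>\<^sub>E C. h c) = (\<Sum>(y, c)\<in>C \<times> (W \<rightarrow>\<^sub>E C). h (c(v := y)))"
    unfolding PiE_insert_eq
    by (subst sum.reindex[OF inj_combinator[OF assms]]) (simp add: case_prod_unfold)
  then show ?thesis
    by (simp add: sum.cartesian_product)
qed

text \<open>Independence under a uniformly random colouring: since \<open>h\<close> ignores the
  value at \<open>v\<close>, all \<open>card C\<close> colours of \<open>v\<close> contribute the
  same sum.\<close>

lemma sum_PiE_colour_indep:
  fixes h :: "('w \<Rightarrow> 'i) \<Rightarrow> real"
  assumes "v \<in> W" "j \<in> C" "finite C" and h: "\<And>c y. h (c(v := y)) = h c"
  shows "(\<Sum>c\<in>W \<rightarrow>\<^sub>E C. of_bool (c v = j) * h c) = (\<Sum>c\<in>W \<rightarrow>\<^sub>E C. h c) / real (card C)"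
proof -
  obtain W' where W: "W = insert v W'" "v \<notin> W'"
    using assms(1) by (meson Set.set_insert)
  have "card C > 0"
    using assms by (auto simp: card_gt_0_iff)
  then show ?thesis
    unfolding W(1) sum_PiE_insert[OF W(2)]
    using assms
    by (auto simp: h simp flip: sum_distrib_left)
qed

text \<open>The factors of the rising factorials are removed starting with the largest one. Then the
  constant of the factor that is removed and the contribution of the vertices that are already
  known to have its colour always add up to \<open>a i + t i - 1\<close>.\<close>

lemma sum_PiE_pochhammer_le:
  fixes a :: "'i \<Rightarrow> real" and t :: "'i \<Rightarrow> nat" and U W :: "'w set"
  assumes "finite W" "finite C" "U \<subseteq> W" "\<And>i. i \<in> C \<Longrightarrow> a i \<ge> 0"
  shows "(\<Sum>c\<in>W \<rightarrow>\<^sub>E C. \<Prod>i\<in>C. pochhammer (real (card {w \<in> U. c w = i}) + a i) (t i))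
    \<le> real (card C) ^ card W *
       (\<Prod>i\<in>C. (real (card U) / real (card C) + a i + real (t i) - 1) ^ t i)"
  using assms(3,4)
proof (induction "sum t C" arbitrary: U a t)
  case 0
  then have "t i = 0" if "i \<in> C" for i
    using that \<open>finite C\<close> by auto
  then show ?case
    by (simp add: card_funcsetE \<open>finite W\<close>)
next
  case (Suc k)
  have "\<exists>j\<in>C. t j \<noteq> 0"
    using Suc(2) by (metis nat.distinct(1) sum.neutral)
  then obtain j s where j: "j \<in> C" and tj: "t j = Suc s"
    using not0_implies_Suc by blast
  define t' where "t' = t(j := s)"
  define C' where "C' = C - {j}"
  have C: "C = insert j C'" "j \<notin> C'" "finite C'"
    using j \<open>finite C\<close> by (auto simp: C'_def)
  have t'C': "t' i = t i" if "i \<in> C'" for i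
    using that by (auto simp: t'_def C'_def)
  have sumt': "sum t' C = k"
    using Suc(2) t'C' C by (simp add: tj t'_def)
  have finU: "finite U"
    using Suc.prems \<open>finite W\<close> finite_subset by blast
  define m N where "m = real (card C)" and "N = real (card U)"
  have m: "m > 0"
    using j \<open>finite C\<close> by (auto simp: m_def card_gt_0_iff)
  have N: "N \<ge> 0"
    by (simp add: N_def)
  define cnt where "cnt U c i = real (card {w \<in> U. c w = i})" for U and c :: "'w \<Rightarrow> 'i" and i
  define X where "X c = (\<Prod>i\<in>C. pochhammer (cnt U c i + a i) (t' i))" for c
  \<comment> \<open>Once \<open>c v = j\<close> is known for a counted vertex \<open>v\<close>, it
    can be deleted from \<open>U\<close> if the constant of colour \<open>j\<close> grows by 1
    instead. \<open>Y v\<close> is \<open>X\<close> rewritten in this way.\<close>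
  define a' where "a' = a(j := a j + 1)"
  define Y where "Y v c = (\<Prod>i\<in>C. pochhammer (cnt (U - {v}) c i + a' i) (t' i))" for v c
  define R where "R = (\<Prod>i\<in>C'. (N / m + a i + real (t i) - 1) ^ t i)"
  define B where "B = m ^ card W * (N / m + a j + real s) ^ s * R"
  have a: "a i \<ge> 0" "a' i \<ge> 0" if "i \<in> C" for i
    using Suc.prems that by (auto simp: a'_def intro: add_nonneg_nonneg)
  \<comment> \<open>For \<open>t i = 0\<close> the base can be negative, but then the power is
    1.\<close>
  have base: "(x + a i + real (t i) - 1) ^ t i \<ge> 0"
    if "i \<in> C" "x \<ge> 0" for x i
    using that a by (cases "t i") auto
  have R: "R \<ge> 0"
    unfolding R_def using m N by (intro prod_nonneg base) (auto simp: C'_def)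
  have XB: "(\<Sum>c\<in>W \<rightarrow>\<^sub>E C. X c) \<le> B"
  proof -
    have "(\<Sum>c\<in>W \<rightarrow>\<^sub>E C. X c) \<le> m ^ card W * (\<Prod>i\<in>C. (N / m + a i + real (t' i) - 1) ^ t' i)"
      unfolding X_def m_def N_def cnt_def
      by (rule Suc.hyps(1)) (use sumt' Suc.prems in auto)
    also have "\<dots> = m ^ card W * (N / m + a j + real s - 1) ^ s * R"
    proof -
      have "(\<Prod>i\<in>C'. (N / m + a i + real (t' i) - 1) ^ t' i) = R"
        unfolding R_def by (intro prod.cong) (simp_all add: t'C')
      then show ?thesis
        using C by (simp add: t'_def mult.assoc)
    qed
    also have "\<dots> \<le> B"
    proof -
      have "(N / m + a j + real s - 1) ^ s \<le> (N / m + a j + real s) ^ s"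
        using m N a[OF j] by (cases s) (auto intro!: power_mono simp del: power_Suc)
      then show ?thesis
        unfolding B_def using m R by (intro mult_left_mono mult_right_mono) auto
    qed
    finally show ?thesis .
  qed
  have YB: "(\<Sum>c\<in>W \<rightarrow>\<^sub>E C. Y v c) \<le> B" if v: "v \<in> U" for v
  proof -
    have cU: "real (card (U - {v})) = N - 1"
      using v finU card_Suc_Diff1[of U v] by (simp add: N_def)
    then have N1: "N - 1 \<ge> 0"
      by (metis of_nat_0_le_iff)
    have "(\<Sum>c\<in>W \<rightarrow>\<^sub>E C. Y v c)
        \<le> m ^ card W * (\<Prod>i\<in>C. ((N - 1) / m + a' i + real (t' i) - 1) ^ t' i)"
      unfolding Y_def m_def cnt_def cU[symmetric]
      by (rule Suc.hyps(1)) (use sumt' Suc.prems a in auto)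
    \<comment> \<open>At \<open>j\<close> the sum of constant and exponent is unchanged: the 1
      gained in \<open>a' j\<close> offsets the 1 lost in \<open>t' j\<close>.\<close>
    also have "(\<Prod>i\<in>C. ((N - 1) / m + a' i + real (t' i) - 1) ^ t' i) =
        ((N - 1) / m + a j + real s) ^ s * (\<Prod>i\<in>C'. ((N - 1) / m + a i + real (t i) - 1) ^ t i)"
    proof -
      have "(\<Prod>i\<in>C'. ((N - 1) / m + a' i + real (t' i) - 1) ^ t' i) =
          (\<Prod>i\<in>C'. ((N - 1) / m + a i + real (t i) - 1) ^ t i)"
        by (intro prod.cong) (auto simp: t'C' a'_def C'_def)
      then show ?thesis
        using C by (simp add: t'_def a'_def add.assoc)
    qed
    also have "\<dots> \<le> (N / m + a j + real s) ^ s * R"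
    proof (rule mult_mono)
      show "((N - 1) / m + a j + real s) ^ s \<le> (N / m + a j + real s) ^ s"
        using m N1 a[OF j] by (intro power_mono) (auto simp: divide_right_mono)
      show "(\<Prod>i\<in>C'. ((N - 1) / m + a i + real (t i) - 1) ^ t i) \<le> R"
        unfolding R_def
      proof (rule prod_mono, rule conjI)
        fix i assume "i \<in> C'"
        then have i: "i \<in> C" by (simp add: C'_def)
        show "((N - 1) / m + a i + real (t i) - 1) ^ t i \<ge> 0"
          using m N1 by (intro base i) auto
        show "((N - 1) / m + a i + real (t i) - 1) ^ t i \<le> (N / m + a i + real (t i) - 1) ^ t i"
        proof (cases "t i")
          case (Suc u)
          then show ?thesis
            using m N1 a(1)[OF i] by (intro power_mono) (auto simp: divide_right_mono)
        qed auto
      qed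
      show "0 \<le> (N / m + a j + real s) ^ s"
        using m N a[OF j] by simp
      show "0 \<le> (\<Prod>i\<in>C'. ((N - 1) / m + a i + real (t i) - 1) ^ t i)"
        using m N1 by (intro prod_nonneg base) (auto simp: C'_def)
    qed
    finally show ?thesis
      using m unfolding B_def by (simp add: mult.assoc)
  qed
  have Xeq: "of_bool (c v = j) * X c = of_bool (c v = j) * Y v c" if "v \<in> U" for v c
  proof (cases "c v = j")
    case True
    have "cnt U c i + a i = cnt (U - {v}) c i + a' i" if "i \<in> C" for i
    proof (cases "i = j")
      case True
      then have "{w \<in> U. c w = i} = insert v {w \<in> U - {v}. c w = i}"
        using \<open>v \<in> U\<close> \<open>c v = j\<close> by auto
      then show ?thesis
        using True finU by (simp add: cnt_def a'_def)
    next
      case False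
      then have "{w \<in> U. c w = i} = {w \<in> U - {v}. c w = i}"
        using \<open>c v = j\<close> by auto
      then show ?thesis
        using False by (simp add: cnt_def a'_def)
    qed
    then show ?thesis
      by (simp add: X_def Y_def)
  qed simp
  \<comment> \<open>Deleting \<open>v\<close> from the counted set is what makes \<open>Y v\<close>
    independent of the colour of \<open>v\<close>.\<close>
  have Yind: "Y v (c(v := y)) = Y v c" for v c y
    unfolding Y_def cnt_def
    by (intro prod.cong arg_cong2[where f=pochhammer] arg_cong2[where f="(+)"] arg_cong[where f=real]
        arg_cong[where f=card]) auto
  \<comment> \<open>The largest factor at colour \<open>j\<close> is
    \<open>cnt U c j + a j + real s\<close>; its count is expanded into one indicator for each
    vertex of \<open>U\<close>.\<close>
  have prod_eq: "(\<Prod>i\<in>C. pochhammer (cnt U c i + a i) (t i)) =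
      (a j + real s) * X c + (\<Sum>v\<in>U. of_bool (c v = j) * Y v c)" for c
  proof -
    have "(\<Prod>i\<in>C. pochhammer (cnt U c i + a i) (t i)) = (cnt U c j + a j + real s) * X c"
    proof -
      have "(\<Prod>i\<in>C'. pochhammer (cnt U c i + a i) (t i)) =
          (\<Prod>i\<in>C'. pochhammer (cnt U c i + a i) (t' i))"
        by (intro prod.cong) (simp_all add: t'C')
      then show ?thesis
        unfolding X_def using C by (simp add: tj t'_def pochhammer_Suc)
    qed
    also have "cnt U c j = (\<Sum>v\<in>U. of_bool (c v = j))"
      using finU by (simp add: cnt_def sum_of_bool_eq Collect_conj_eq)
    also have "((\<Sum>v\<in>U. of_bool (c v = j)) + a j + real s) * X c =
        (a j + real s) * X c + (\<Sum>v\<in>U. of_bool (c v = j) * X c)"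
      by (simp add: distrib_right sum_distrib_right)
    finally show ?thesis
      using Xeq by simp
  qed
  have "(\<Sum>c\<in>W \<rightarrow>\<^sub>E C. \<Prod>i\<in>C. pochhammer (cnt U c i + a i) (t i)) =
      (a j + real s) * (\<Sum>c\<in>W \<rightarrow>\<^sub>E C. X c) +
      (\<Sum>v\<in>U. \<Sum>c\<in>W \<rightarrow>\<^sub>E C. of_bool (c v = j) * Y v c)"
    unfolding prod_eq sum.distrib sum_distrib_left
    by (subst (2) sum.swap) simp
  also have "(\<Sum>v\<in>U. \<Sum>c\<in>W \<rightarrow>\<^sub>E C. of_bool (c v = j) * Y v c) =
      (\<Sum>v\<in>U. (\<Sum>c\<in>W \<rightarrow>\<^sub>E C. Y v c) / m)"
    unfolding m_def
    by (intro sum.cong refl sum_PiE_colour_indep) (use Suc.prems j \<open>finite C\<close> Yind in auto)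
  also have "(a j + real s) * (\<Sum>c\<in>W \<rightarrow>\<^sub>E C. X c) + \<dots> \<le> (a j + real s) * B + (\<Sum>v\<in>U. B / m)"
    using a[OF j] XB YB m
    by (intro add_mono mult_left_mono sum_mono divide_right_mono) auto
  also have "\<dots> = (N / m + a j + real s) * B"
    by (simp add: N_def algebra_simps)
  also have "\<dots> = m ^ card W * (\<Prod>i\<in>C. (N / m + a i + real (t i) - 1) ^ t i)"
    using C by (simp add: B_def R_def tj algebra_simps)
  finally show ?case
    by (simp add: cnt_def m_def N_def)
qed

section \<open>Staircases\<close>

text \<open>These are the chains of the product preorder given by \<open>f\<close> and
  \<open>g\<close>, that is, the vertex sets of simplices in the staircase triangulation of a
  product of two simplices.\<close>

definition noncrossing :: "('x \<Rightarrow> nat) \<Rightarrow> ('w \<Rightarrow> nat) \<Rightarrow> ('x \<times> 'w) set \<Rightarrow> bool" where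
  "noncrossing f g A \<longleftrightarrow> (\<forall>(x, w)\<in>A. \<forall>(x', w')\<in>A. \<not> (f x < f x' \<and> g w' < g w))"

lemma noncrossing_subset: "noncrossing f g A \<Longrightarrow> B \<subseteq> A \<Longrightarrow> noncrossing f g B"
  unfolding noncrossing_def by blast

lemma noncrossingD:
  "noncrossing f g A \<Longrightarrow> (x, w) \<in> A \<Longrightarrow> (x', w') \<in> A \<Longrightarrow> f x < f x' \<Longrightarrow> \<not> g w' < g w"
  unfolding noncrossing_def by blast

lemma ex_last_inj:
  fixes f :: "'x \<Rightarrow> nat"
  assumes "finite X" "X \<noteq> {}" "inj_on f X"
  obtains x where "x \<in> X" "\<And>y. y \<in> X - {x} \<Longrightarrow> f y < f x"
proof -
  have "Max (f ` X) \<in> f ` X"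
    using assms by simp
  then obtain x where x: "x \<in> X" "f x = Max (f ` X)"
    by auto
  have "f y < f x" if "y \<in> X - {x}" for y
  proof -
    have "f y \<le> f x"
      using that assms by (simp add: x)
    moreover have "f y \<noteq> f x"
      using that assms(3) x(1) by (auto dest: inj_onD)
    ultimately show ?thesis by simp
  qed
  then show ?thesis
    using that x by blast
qed

text \<open>Elements other than the last corner in both its row and its column would cross. Deleting
  the corner therefore frees a row or a column, which drives the inductions for the size and the
  number of staircases.\<close>

lemma noncrossing_remove_last:
  assumes "noncrossing f g A" "A \<subseteq> X \<times> W"
    and x: "\<And>y. y \<in> X - {x} \<Longrightarrow> f y < f x" and w: "\<And>y. y \<in> W - {w} \<Longrightarrow> g y < g w"
  shows "A - {(x, w)} \<subseteq> (X - {x}) \<times> W \<or> A - {(x, w)} \<subseteq> X \<times> (W - {w})"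
proof (rule ccontr)
  assume "\<not> ?thesis"
  then obtain w' x' where "(x, w') \<in> A" "w' \<noteq> w" "(x', w) \<in> A" "x' \<noteq> x"
    using assms(2) by blast
  moreover have "f x' < f x" "g w' < g w"
    using calculation assms(2) x w by blast+
  ultimately show False
    using noncrossingD[OF assms(1)] by blast
qed

text \<open>A staircase gains at most one element with each further row or column. The bound is
  split off as \<open>card X - 1\<close> because this becomes an entry of a simplex type. The set
  \<open>W\<close> may be empty, as happens for a colour that a simplex of \<open>Q\<close>
  misses.\<close>

lemma card_noncrossing_le:
  assumes "finite X" "X \<noteq> {}" "finite W" "inj_on f X" "inj_on g W"
    and "noncrossing f g A" "A \<subseteq> X \<times> W"
  shows "card A \<le> card X - 1 + card W"
  using assms
proof (induction "card X + card W" arbitrary: X W A rule: less_induct)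
  case less
  have fin: "finite A"
    using less.prems finite_subset by blast
  show ?case
  proof (cases "W = {} \<or> card X = 1")
    case True
    then show ?thesis
      using less.prems card_mono[of "X \<times> W" A] by (auto simp: card_cartesian_product)
  next
    case False
    then have cX: "card X \<ge> 2" and cW: "card W > 0"
      using less.prems by (auto simp: Suc_le_eq card_gt_0_iff numeral_2_eq_2 intro: le_neq_implies_less)
    obtain x where x: "x \<in> X" "\<And>y. y \<in> X - {x} \<Longrightarrow> f y < f x"
      using ex_last_inj less.prems by metis
    obtain w where w: "w \<in> W" "\<And>y. y \<in> W - {w} \<Longrightarrow> g y < g w"
      using ex_last_inj less.prems False by metis
    let ?A = "A - {(x, w)}"
    have nc: "noncrossing f g ?A"
      using less.prems(6) by (rule noncrossing_subset) auto
    have "card ?A \<le> card X - 1 + card W - 1"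
      using noncrossing_remove_last[OF less.prems(6,7) x(2) w(2)]
    proof
      assume "?A \<subseteq> (X - {x}) \<times> W"
      moreover have "X - {x} \<noteq> {}"
        using cX by (metis Diff_eq_empty_iff card_le_Suc0_iff_eq less.prems(1) not_less_eq_eq numeral_2_eq_2 singletonD subset_iff)
      ultimately have "card ?A \<le> card (X - {x}) - 1 + card W"
        using less.prems x cX nc by (intro less.hyps) (auto intro: inj_on_subset)
      then show ?thesis
        using x cX by simp
    next
      assume "?A \<subseteq> X \<times> (W - {w})"
      then have "card ?A \<le> card X - 1 + card (W - {w})"
        using less.prems w cW nc by (intro less.hyps) (auto intro: inj_on_subset)
      then show ?thesis
        using w cW by simp
    qed
    then show ?thesis
      using cX cW card_Diff1_le[of A "(x, w)"] card_Suc_Diff1[of A "(x,w)"] fin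
      by (cases "(x, w) \<in> A") auto
  qed
qed

text \<open>Pascal's rule: \<open>pochhammer (real n) t / fact t\<close> is the binomial coefficient
  of \<open>n + t - 1\<close> over \<open>t\<close>.\<close>

lemma pochhammer_div_fact_rec:
  fixes n :: nat
  assumes "n > 0"
  shows "pochhammer (real n) (Suc t) / fact (Suc t) =
    pochhammer (real n) t / fact t + pochhammer (real (n - 1)) (Suc t) / fact (Suc t)"
proof -
  have "pochhammer (real (n - 1)) (Suc t) = real (n - 1) * pochhammer (real n) t"
    using assms by (simp add: pochhammer_rec of_nat_diff add.commute)
  moreover have "pochhammer (real n) (Suc t) = (real (n - 1) + real (Suc t)) * pochhammer (real n) t"
    using assms by (simp add: pochhammer_Suc of_nat_diff)
  ultimately show ?thesis
    by (simp only: fact_Suc of_nat_mult) (simp add: divide_simps, simp add: algebra_simps)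
qed

text \<open>Maximal staircases are lattice paths, counted by Pascal's rule: deleting the last corner
  is injective on them and leaves a maximal staircase of a grid with one row or column less. The
  rising factorial is the form that is averaged over colourings.\<close>

lemma card_maximal_noncrossing_le:
  assumes "finite X" "X \<noteq> {}" "finite W" "inj_on f X" "inj_on g W"
  shows "real (card {A. A \<subseteq> X \<times> W \<and> noncrossing f g A \<and> card A = card X - 1 + card W})
    \<le> pochhammer (real (card W)) (card X - 1) / fact (card X - 1)"
  using assms
proof (induction "card X + card W" arbitrary: X W rule: less_induct)
  case less
  define F where
    "F X W = {A. A \<subseteq> X \<times> W \<and> noncrossing f g A \<and> card A = card X - 1 + card W}" for X W
  have finF: "finite (F X W)" if "finite X" "finite W" for X W
    by (rule finite_subset[of _ "Pow (X \<times> W)"]) (use that in \<open>auto simp: F_def\<close>)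
  show ?case
  proof (cases "card X = 1 \<or> W = {}")
    case True
    have "A = X \<times> W \<and> (card X = 1)" if "A \<in> F X W" for A
    proof -
      have "card X \<ge> 1"
        using less.prems by (simp add: Suc_leI card_gt_0_iff)
      then have "card (X \<times> W) \<le> card A" "card X = 1"
        using that True by (auto simp: F_def card_cartesian_product)
      then show ?thesis
        using that card_subset_eq[of "X \<times> W" A] card_mono[of "X \<times> W" A] less.prems
        by (auto simp: F_def)
    qed
    \<comment> \<open>If \<open>W = {}\<close> and \<open>card X > 1\<close>, a member would be a
      nonempty subset of the empty grid.\<close>
    then have "F X W \<subseteq> (if card X = 1 then {X \<times> W} else {})"
      by auto
    then have "card (F X W) \<le> card (if card X = 1 then {X \<times> W} else {})"
      by (intro card_mono) auto
    then have "real (card (F X W)) \<le> (if card X = 1 then 1 else 0)"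
      by (auto split: if_splits)
    also have "\<dots> \<le> pochhammer (real (card W)) (card X - 1) / fact (card X - 1)"
      by (auto intro!: divide_nonneg_pos simp: pochhammer_of_nat)
    finally show ?thesis
      by (simp add: F_def)
  next
    case False
    then have "card X \<noteq> 0"
      using less.prems by simp
    then obtain t where t: "card X = Suc (Suc t)"
      using False by (metis One_nat_def old.nat.exhaust)
    have cW: "card W > 0"
      using False less.prems by (simp add: card_gt_0_iff)
    obtain x where x: "x \<in> X" "\<And>y. y \<in> X - {x} \<Longrightarrow> f y < f x"
      using ex_last_inj less.prems by metis
    obtain w where w: "w \<in> W" "\<And>y. y \<in> W - {w} \<Longrightarrow> g y < g w"
      using ex_last_inj less.prems False by metis
    have cXx: "card (X - {x}) = Suc t"
      using x t by simp
    then have Xx: "card (X - {x}) = Suc t" "X - {x} \<noteq> {}"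
      by (simp, metis card.empty nat.distinct(1))
    have Ww: "card (W - {w}) = card W - 1"
      using w by simp
    \<comment> \<open>The last corner cannot be missing: \<open>A\<close> would then fit into a
      smaller grid, whose staircases have at least one element less.\<close>
    have step: "(x, w) \<in> A \<and> A - {(x, w)} \<in> F (X - {x}) W \<union> F X (W - {w})" if "A \<in> F X W" for A
    proof -
      have A: "A \<subseteq> X \<times> W" "noncrossing f g A" "card A = Suc t + card W"
        using that t by (auto simp: F_def)
      have nc: "noncrossing f g (A - {(x, w)})"
        using A(2) by (rule noncrossing_subset) auto
      have fin: "finite A"
        using A(1) less.prems finite_subset by blast
      have cA: "card A \<le> Suc (card (A - {(x, w)}))"
        by (metis card_Diff1_le card_Suc_Diff1 fin le_Suc_eq order_refl Diff_insert_absorb Diff_empty Diff_insert0)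
      from noncrossing_remove_last[OF A(2,1) x(2) w(2)]
      consider "A - {(x, w)} \<subseteq> (X - {x}) \<times> W" | "A - {(x, w)} \<subseteq> X \<times> (W - {w})"
        by blast
      then show ?thesis
      proof cases
        case 1
        then have le: "card (A - {(x, w)}) \<le> t + card W"
          using card_noncrossing_le[of "X - {x}" W f g "A - {(x, w)}"] less.prems Xx nc
          by (auto intro: inj_on_subset)
        then have "(x, w) \<in> A"
          using A(3) by (cases "(x, w) \<in> A") auto
        moreover have "card (A - {(x, w)}) = t + card W"
          using le cA A(3) by simp
        ultimately show ?thesis
          using 1 nc Xx by (auto simp: F_def)
      next
        case 2
        then have le: "card (A - {(x, w)}) \<le> Suc t + (card W - 1)"
          using card_noncrossing_le[of X "W - {w}" f g "A - {(x, w)}"] less.prems t Ww nc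
          by (auto intro: inj_on_subset)
        then have "(x, w) \<in> A"
          using A(3) cW by (cases "(x, w) \<in> A") auto
        moreover have "card (A - {(x, w)}) = Suc t + (card W - 1)"
          using le cA A(3) cW by simp
        ultimately show ?thesis
          using 2 nc t Ww by (auto simp: F_def)
      qed
    qed
    have "card (F X W) = card ((\<lambda>A. A - {(x, w)}) ` F X W)"
      by (rule card_image[symmetric], rule inj_onI) (use step in \<open>metis insert_Diff\<close>)
    also have "\<dots> \<le> card (F (X - {x}) W \<union> F X (W - {w}))"
      using step less.prems by (intro card_mono finite_UnI finF) auto
    also have "\<dots> \<le> card (F (X - {x}) W) + card (F X (W - {w}))"
      by (rule card_Un_le)
    finally have "real (card (F X W)) \<le> real (card (F (X - {x}) W)) + real (card (F X (W - {w})))"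
      by linarith
    also have "real (card (F (X - {x}) W)) \<le> pochhammer (real (card W)) t / fact t"
      unfolding F_def using less.hyps[of "X - {x}" W] less.prems Xx t
      by (simp add: inj_on_diff)
    also have "real (card (F X (W - {w}))) \<le> pochhammer (real (card W - 1)) (Suc t) / fact (Suc t)"
      unfolding F_def using less.hyps[of X "W - {w}"] less.prems Ww t cW
      by (simp add: inj_on_diff)
    finally show ?thesis
      using pochhammer_div_fact_rec[OF cW, of t] t by (simp add: F_def)
  qed
qed

text \<open>The last corner dominates the whole grid, so it is comparable to every pair.\<close>

lemma noncrossing_insert_last:
  assumes "noncrossing f g A" "A \<subseteq> X \<times> W"
    and "\<And>y. y \<in> X - {x} \<Longrightarrow> f y < f x" "\<And>y. y \<in> W - {w} \<Longrightarrow> g y < g w"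
  shows "noncrossing f g (insert (x, w) A)"
proof -
  have f: "f y \<le> f x" if "y \<in> X" for y
    using assms(3)[of y] that by (cases "y = x") auto
  have g: "g y \<le> g w" if "y \<in> W" for y
    using assms(4)[of y] that by (cases "y = w") auto
  have "\<not> (f a < f b \<and> g d < g c)" if "(a, c) \<in> insert (x, w) A" "(b, d) \<in> insert (x, w) A" for a b c d
    using that noncrossingD[OF assms(1), of a c b d] f[of b] g[of c] assms(2) by auto
  then show ?thesis
    unfolding noncrossing_def by blast
qed

section \<open>Couplings with noncrossing support\<close>

text \<open>These are transportation plans of arbitrary total mass: they are used inside one colour
  class, which may carry only part of the barycentric mass.\<close>

definition coupling :: "'x set \<Rightarrow> 'w set \<Rightarrow> ('x \<Rightarrow> real) \<Rightarrow> ('w \<Rightarrow> real) \<Rightarrow> ('x \<times> 'w \<Rightarrow> real) \<Rightarrow> bool" where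
  "coupling X W p q k \<longleftrightarrow> (\<forall>z\<in>X \<times> W. k z \<ge> 0) \<and>
     (\<forall>x\<in>X. (\<Sum>w\<in>W. k (x, w)) = p x) \<and> (\<forall>w\<in>W. (\<Sum>x\<in>X. k (x, w)) = q w)"

lemma coupling_swap: "coupling X W p q k \<Longrightarrow> coupling W X q p (\<lambda>(w, x). k (x, w))"
  unfolding coupling_def by auto

lemma noncrossing_swap:
  "noncrossing f g {z \<in> X \<times> W. k z \<noteq> 0} \<Longrightarrow>
   noncrossing g f {z \<in> W \<times> X. (\<lambda>(w, x). k (x, w)) z \<noteq> 0}"
  unfolding noncrossing_def by fastforce

text \<open>All mass of row \<open>x\<close> sits at \<open>(x, w)\<close>, so deleting the row
  lowers the demand of column \<open>w\<close> by \<open>p x\<close> and changes no other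
  column.\<close>

lemma coupling_remove_row:
  assumes "finite X" "finite W" "x \<in> X" "w \<in> W" and k: "coupling X W p q k"
    and row: "\<And>w'. w' \<in> W - {w} \<Longrightarrow> k (x, w') = 0"
  shows "coupling (X - {x}) W p (q(w := q w - p x)) k" "k (x, w) = p x"
proof -
  have "p x = (\<Sum>w'\<in>W. k (x, w'))"
    using k assms(3) by (simp add: coupling_def)
  also have "\<dots> = k (x, w)"
    using assms row by (simp add: sum.remove[of W w])
  finally show px: "k (x, w) = p x" by simp
  have "(\<Sum>x'\<in>X - {x}. k (x', w')) = (q(w := q w - p x)) w'" if w': "w' \<in> W" for w'
  proof -
    have "q w' = k (x, w') + (\<Sum>x'\<in>X - {x}. k (x', w'))"
      using k w' assms by (simp add: coupling_def sum.remove[of X x])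
    then show ?thesis
      using px row[of w'] w' by auto
  qed
  then show "coupling (X - {x}) W p (q(w := q w - p x)) k"
    using k by (simp add: coupling_def)
qed

text \<open>Another nonzero entry in the last row would force column \<open>w\<close> to vanish away
  from the corner; then \<open>q w = k (x, w) < p x\<close>, against
  \<open>p x \<le> q w\<close>.\<close>

lemma noncrossing_coupling_last_row:
  assumes "finite X" "finite W" "x \<in> X" "w \<in> W" and k: "coupling X W p q k"
    and nc: "noncrossing f g {z \<in> X \<times> W. k z \<noteq> 0}" and le: "p x \<le> q w"
    and x: "\<And>y. y \<in> X - {x} \<Longrightarrow> f y < f x" and w: "\<And>y. y \<in> W - {w} \<Longrightarrow> g y < g w"
    and w': "w' \<in> W - {w}"
  shows "k (x, w') = 0"
proof (rule ccontr)
  assume n0: "k (x, w') \<noteq> 0"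
  have k0: "k z \<ge> 0" if "z \<in> X \<times> W" for z
    using k that by (auto simp: coupling_def)
  have col: "k (x', w) = 0" if "x' \<in> X - {x}" for x'
  proof (rule ccontr)
    assume "k (x', w) \<noteq> 0"
    moreover have "f x' < f x" "g w' < g w"
      using that x w w' by auto
    ultimately show False
      using noncrossingD[OF nc, of x' w x w'] n0 that w' assms by auto
  qed
  have "k (x, w) < (\<Sum>w\<in>W. k (x, w))"
  proof -
    have "k (x, w) < k (x, w) + k (x, w')"
      using n0 k0[of "(x, w')"] w' assms by auto
    also have "\<dots> = (\<Sum>w\<in>{w, w'}. k (x, w))"
      using w' by auto
    also have "\<dots> \<le> (\<Sum>w\<in>W. k (x, w))"
      using w' assms k0 by (intro sum_mono2) auto
    finally show ?thesis .
  qed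
  also have "\<dots> = p x"
    using k assms by (simp add: coupling_def)
  also have "\<dots> \<le> (\<Sum>x\<in>X. k (x, w))"
    using le k assms by (simp add: coupling_def)
  also have "\<dots> = k (x, w)"
    using col assms by (simp add: sum.remove[of X x])
  finally show False by simp
qed

text \<open>The smaller of \<open>p x\<close> and \<open>q w\<close> decides whether the last row or
  the last column is concentrated in the corner. Both couplings agree there, and deleting that line
  leaves couplings with equal marginals.\<close>

lemma noncrossing_coupling_unique:
  assumes "finite X" "finite W" "inj_on f X" "inj_on g W"
    and "coupling X W p q k" "noncrossing f g {z \<in> X \<times> W. k z \<noteq> 0}"
    and "coupling X W p q k'" "noncrossing f g {z \<in> X \<times> W. k' z \<noteq> 0}"
    and "z \<in> X \<times> W"
  shows "k z = k' z"
proof -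
  have "\<forall>z\<in>X \<times> W. k z = k' z"
    using assms(1-8)
  proof (induction "card X + card W" arbitrary: X W p q rule: less_induct)
    case less
    show ?case
    proof (cases "X = {} \<or> W = {}")
      case False
      obtain x where x: "x \<in> X" "\<And>y. y \<in> X - {x} \<Longrightarrow> f y < f x"
        using ex_last_inj less.prems False by metis
      obtain w where w: "w \<in> W" "\<And>y. y \<in> W - {w} \<Longrightarrow> g y < g w"
        using ex_last_inj less.prems False by metis
      note nc = less.prems(6,8)
      show ?thesis
      proof (cases "p x \<le> q w")
        case True
        have row: "k (x, w') = 0" "k' (x, w') = 0" if "w' \<in> W - {w}" for w'
          using noncrossing_coupling_last_row[OF less.prems(1,2) x(1) w(1) less.prems(5,6) True x(2) w(2) that]
            noncrossing_coupling_last_row[OF less.prems(1,2) x(1) w(1) less.prems(7,8) True x(2) w(2) that]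
          by auto
        note r = coupling_remove_row[OF less.prems(1,2) x(1) w(1) less.prems(5) row(1)]
        note r' = coupling_remove_row[OF less.prems(1,2) x(1) w(1) less.prems(7) row(2)]
        have "\<forall>z\<in>(X - {x}) \<times> W. k z = k' z"
        proof (rule less.hyps)
          show "card (X - {x}) + card W < card X + card W"
            using card_Diff1_less[OF less.prems(1) x(1)] by linarith
          show "noncrossing f g {z \<in> (X - {x}) \<times> W. k z \<noteq> 0}"
               "noncrossing f g {z \<in> (X - {x}) \<times> W. k' z \<noteq> 0}"
            by (rule noncrossing_subset[OF nc(1)] noncrossing_subset[OF nc(2)]; auto)+
        qed (use less.prems r r' in \<open>auto intro: inj_on_subset\<close>)
        moreover have "k (x, w') = k' (x, w')" if "w' \<in> W" for w'
          using row that r(2) r'(2) by (cases "w' = w") auto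
        ultimately show ?thesis
          by force
      next
        case False
        then have le: "q w \<le> p x" by simp
        \<comment> \<open>Transposition turns the last column into a last row.\<close>
        define l l' where "l = (\<lambda>(w, x). k (x, w))" and "l' = (\<lambda>(w, x). k' (x, w))"
        have cpl: "coupling W X q p l" "coupling W X q p l'"
          unfolding l_def l'_def by (rule coupling_swap less.prems(5,7))+
        have ncl: "noncrossing g f {z \<in> W \<times> X. l z \<noteq> 0}" "noncrossing g f {z \<in> W \<times> X. l' z \<noteq> 0}"
          unfolding l_def l'_def by (rule noncrossing_swap[OF nc(1)] noncrossing_swap[OF nc(2)])+
        have row: "l (w, x') = 0" "l' (w, x') = 0" if "x' \<in> X - {x}" for x'
          using noncrossing_coupling_last_row[OF less.prems(2,1) w(1) x(1) cpl(1) ncl(1) le w(2) x(2) that]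
            noncrossing_coupling_last_row[OF less.prems(2,1) w(1) x(1) cpl(2) ncl(2) le w(2) x(2) that]
          by auto
        note r = coupling_remove_row[OF less.prems(2,1) w(1) x(1) cpl(1) row(1)]
        note r' = coupling_remove_row[OF less.prems(2,1) w(1) x(1) cpl(2) row(2)]
        have "\<forall>z\<in>X \<times> (W - {w}). k z = k' z"
        proof (rule less.hyps)
          show "card X + card (W - {w}) < card X + card W"
            using card_Diff1_less[OF less.prems(2) w(1)] by linarith
          show "noncrossing f g {z \<in> X \<times> (W - {w}). k z \<noteq> 0}"
               "noncrossing f g {z \<in> X \<times> (W - {w}). k' z \<noteq> 0}"
            by (rule noncrossing_subset[OF nc(1)] noncrossing_subset[OF nc(2)]; auto)+
          show "coupling X (W - {w}) (p(x := p x - q w)) q k"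
               "coupling X (W - {w}) (p(x := p x - q w)) q k'"
            using coupling_swap[OF r(1)] coupling_swap[OF r'(1)] by (simp_all add: l_def l'_def)
        qed (use less.prems in \<open>auto intro: inj_on_subset\<close>)
        moreover have "k (x', w) = k' (x', w)" if "x' \<in> X" for x'
          using row that r(2) r'(2) by (cases "x' = x") (auto simp: l_def l'_def)
        ultimately show ?thesis
          by force
      qed
    qed auto
  qed
  then show ?thesis
    using assms(9) by blast
qed

lemma coupling_add_row:
  assumes "finite X" "finite W" "x \<in> X" "w \<in> W" "p x \<ge> 0"
    and k: "coupling (X - {x}) W p (q(w := q w - p x)) k"
  defines "k' \<equiv> (\<lambda>z. if z = (x, w) then p x else if fst z = x then 0 else k z)"
  shows "coupling X W p q k'"
    "{z \<in> X \<times> W. k' z \<noteq> 0} \<subseteq> insert (x, w) {z \<in> (X - {x}) \<times> W. k z \<noteq> 0}"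
proof -
  have "(\<Sum>w'\<in>W. k' (x', w')) = p x'" if "x' \<in> X" for x'
  proof (cases "x' = x")
    case True
    then show ?thesis
      using assms by (simp add: k'_def sum.remove[of W w])
  next
    case False
    then show ?thesis
      using k that by (simp add: k'_def coupling_def)
  qed
  moreover have "(\<Sum>x'\<in>X. k' (x', w')) = q w'" if "w' \<in> W" for w'
  proof -
    have "(\<Sum>x'\<in>X - {x}. k' (x', w')) = (\<Sum>x'\<in>X - {x}. k (x', w'))"
      by (intro sum.cong) (auto simp: k'_def)
    also have "\<dots> = (q(w := q w - p x)) w'"
      using k that unfolding coupling_def by blast
    finally show ?thesis
      using assms(1,3) by (simp add: sum.remove[of X x] k'_def)
  qed
  moreover have "k' z \<ge> 0" if "z \<in> X \<times> W" for z
    using k that assms(5) by (auto simp: k'_def coupling_def)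
  ultimately show "coupling X W p q k'"
    by (simp add: coupling_def)
  show "{z \<in> X \<times> W. k' z \<noteq> 0} \<subseteq> insert (x, w) {z \<in> (X - {x}) \<times> W. k z \<noteq> 0}"
    by (auto simp: k'_def)
qed

text \<open>The northwest corner rule of transportation theory, started at the last corner.\<close>

lemma noncrossing_coupling_exists:
  assumes "finite X" "finite W" "inj_on f X" "inj_on g W"
    and "\<And>x. x \<in> X \<Longrightarrow> p x \<ge> 0" "\<And>w. w \<in> W \<Longrightarrow> q w \<ge> 0" "sum p X = sum q W"
  shows "\<exists>k. coupling X W p q k \<and> noncrossing f g {z \<in> X \<times> W. k z \<noteq> 0}"
  using assms
proof (induction "card X + card W" arbitrary: X W p q rule: less_induct)
  case less
  show ?case
  proof (cases "X = {} \<or> W = {}")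
    case True
    \<comment> \<open>Equal totals and nonnegativity make the marginal on the other side vanish
      too.\<close>
    then have "\<forall>x\<in>X. p x = 0" "\<forall>w\<in>W. q w = 0"
      using less.prems by (auto simp: sum_nonneg_eq_0_iff)
    then have "coupling X W p q (\<lambda>_. 0)"
      using True by (auto simp: coupling_def)
    then show ?thesis
      by (auto simp: noncrossing_def)
  next
    case False
    obtain x where x: "x \<in> X" "\<And>y. y \<in> X - {x} \<Longrightarrow> f y < f x"
      using ex_last_inj less.prems False by metis
    obtain w where w: "w \<in> W" "\<And>y. y \<in> W - {w} \<Longrightarrow> g y < g w"
      using ex_last_inj less.prems False by metis
    \<comment> \<open>The corner receives the smaller of \<open>p x\<close> and \<open>q w\<close>,
      which uses up its row or its column.\<close>
    show ?thesis
    proof (cases "p x \<le> q w")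
      case True
      have "\<exists>k. coupling (X - {x}) W p (q(w := q w - p x)) k \<and>
          noncrossing f g {z \<in> (X - {x}) \<times> W. k z \<noteq> 0}"
      proof (rule less.hyps)
        show "card (X - {x}) + card W < card X + card W"
          using card_Diff1_less[OF less.prems(1) x(1)] by linarith
        show "sum p (X - {x}) = sum (q(w := q w - p x)) W"
          using less.prems x w by (simp add: sum.remove[of X x] sum.remove[of W w])
      qed (use less.prems True in \<open>auto intro: inj_on_subset\<close>)
      then obtain k where k: "coupling (X - {x}) W p (q(w := q w - p x)) k"
          "noncrossing f g {z \<in> (X - {x}) \<times> W. k z \<noteq> 0}"
        by blast
      have "noncrossing f g (insert (x, w) {z \<in> (X - {x}) \<times> W. k z \<noteq> 0})"
        by (rule noncrossing_insert_last[OF k(2) _ x(2) w(2)]) auto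
      note nc = noncrossing_subset[OF this]
      note r = coupling_add_row[OF less.prems(1,2) x(1) w(1) less.prems(5)[OF x(1)] k(1)]
      show ?thesis
        by (intro exI conjI, rule r(1), rule nc, rule r(2))
    next
      case False
      have "\<exists>k. coupling X (W - {w}) (p(x := p x - q w)) q k \<and>
          noncrossing f g {z \<in> X \<times> (W - {w}). k z \<noteq> 0}"
      proof (rule less.hyps)
        show "card X + card (W - {w}) < card X + card W"
          using card_Diff1_less[OF less.prems(2) w(1)] by linarith
        show "sum (p(x := p x - q w)) X = sum q (W - {w})"
          using less.prems x w by (simp add: sum.remove[of X x] sum.remove[of W w])
      qed (use less.prems False in \<open>auto intro: inj_on_subset\<close>)
      then obtain k where k: "coupling X (W - {w}) (p(x := p x - q w)) q k"
          "noncrossing f g {z \<in> X \<times> (W - {w}). k z \<noteq> 0}"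
        by blast
      have "noncrossing g f (insert (w, x) {z \<in> (W - {w}) \<times> X. (\<lambda>(w, x). k (x, w)) z \<noteq> 0})"
        by (rule noncrossing_insert_last[OF noncrossing_swap[OF k(2)] _ w(2) x(2)]) auto
      note nc = noncrossing_subset[OF this]
      note r = coupling_add_row[OF less.prems(2,1) w(1) x(1) less.prems(6)[OF w(1)]
          coupling_swap[OF k(1)]]
      obtain l where "coupling W X q p l" "noncrossing g f {z \<in> W \<times> X. l z \<noteq> 0}"
        using r(1) nc[OF r(2)] by blast
      then have "coupling X W p q (\<lambda>(x, w). l (w, x)) \<and>
          noncrossing f g {z \<in> X \<times> W. (\<lambda>(x, w). l (w, x)) z \<noteq> 0}"
        by (intro conjI coupling_swap noncrossing_swap)
      then show ?thesis by blast
    qed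
  qed
qed

section \<open>Barycentric coordinates and triangulations\<close>

text \<open>Coordinates are functions on the whole space that vanish off \<open>A\<close>, so that
  coordinates with respect to different vertex sets can be compared by plain equality.\<close>

definition bary :: "'v set \<Rightarrow> ('v::real_vector \<Rightarrow> real) \<Rightarrow> 'v \<Rightarrow> bool" where
  "bary A u z \<longleftrightarrow> (\<forall>x. u x \<ge> 0) \<and> (\<forall>x. x \<notin> A \<longrightarrow> u x = 0) \<and> sum u A = 1 \<and> (\<Sum>x\<in>A. u x *\<^sub>R x) = z"

lemma bary_nonneg: "bary A u z \<Longrightarrow> u x \<ge> 0"
  by (simp add: bary_def)

lemma bary_support: "bary A u z \<Longrightarrow> u x \<noteq> 0 \<Longrightarrow> x \<in> A"
  unfolding bary_def by blast

lemma convex_hull_bary: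
  assumes "finite A"
  shows "z \<in> convex hull A \<longleftrightarrow> (\<exists>u. bary A u z)"
proof
  assume "z \<in> convex hull A"
  then obtain u where u: "\<forall>x\<in>A. 0 \<le> u x" "sum u A = 1" "(\<Sum>x\<in>A. u x *\<^sub>R x) = z"
    using convex_hull_finite[OF assms] by auto
  let ?u = "\<lambda>x. if x \<in> A then u x else 0"
  have "sum ?u A = 1" "(\<Sum>x\<in>A. ?u x *\<^sub>R x) = z"
    using u(2,3) by (simp_all cong: sum.cong)
  then have "bary A ?u z"
    using u(1) by (simp add: bary_def)
  then show "\<exists>u. bary A u z" by blast
qed (auto simp: convex_hull_finite[OF assms] bary_def)

lemma bary_mono:
  assumes "bary A u z" "A \<subseteq> B" "finite B"
  shows "bary B u z"
proof -
  have "sum u B = sum u A" "(\<Sum>x\<in>B. u x *\<^sub>R x) = (\<Sum>x\<in>A. u x *\<^sub>R x)"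
    by (rule sum.mono_neutral_right; use assms in \<open>auto simp: bary_def\<close>)+
  then show ?thesis
    using assms by (auto simp: bary_def)
qed

lemma bary_restrict:
  assumes "bary B u z" "finite B" "\<And>x. u x \<noteq> 0 \<Longrightarrow> x \<in> A" "A \<subseteq> B"
  shows "bary A u z"
proof -
  have "sum u B = sum u A" "(\<Sum>x\<in>B. u x *\<^sub>R x) = (\<Sum>x\<in>A. u x *\<^sub>R x)"
    by (rule sum.mono_neutral_right; use assms in \<open>auto simp: bary_def\<close>)+
  then show ?thesis
    using assms by (auto simp: bary_def)
qed

lemma bary_unique:
  assumes "\<not> affine_dependent A" "finite A" "bary A u z" "bary A v z"
  shows "u = v"
proof
  fix x
  show "u x = v x"
  proof (cases "x \<in> A")
    case True
    have "sum (\<lambda>x. u x - v x) A = 0" "(\<Sum>x\<in>A. (u x - v x) *\<^sub>R x) = 0"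
      using assms(3,4) by (simp_all add: bary_def sum_subtractf scaleR_left_diff_distrib)
    then have "u x - v x = 0"
      using assms(1) True unfolding affine_dependent_explicit_finite[OF assms(2)] by blast
    then show ?thesis by simp
  qed (use assms in \<open>simp add: bary_def\<close>)
qed

text \<open>Coordinates are pushed forward like a measure. Only the support has to land in
  \<open>B\<close>, which lets \<open>E\<close> be the full grid of vertices while \<open>B\<close>
  belongs to a single simplex.\<close>

lemma bary_pushforward:
  fixes h :: "'v::real_vector \<Rightarrow> 'w::real_vector"
  assumes u: "bary E u z" and "finite E" "finite B" and h: "\<And>x. x \<in> E \<Longrightarrow> u x \<noteq> 0 \<Longrightarrow> h x \<in> B"
  shows "bary B (\<lambda>y. \<Sum>x | x \<in> E \<and> h x = y. u x) (\<Sum>x\<in>E. u x *\<^sub>R h x)"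
proof -
  define F where "F = {x\<in>E. u x \<noteq> 0}"
  have F: "finite F" "h ` F \<subseteq> B"
    using assms by (auto simp: F_def)
  have restr: "(\<Sum>x | x \<in> E \<and> h x = y. u x) = (\<Sum>x | x \<in> F \<and> h x = y. u x)" for y
    using \<open>finite E\<close> by (intro sum.mono_neutral_right) (auto simp: F_def)
  have "(\<Sum>y\<in>B. (\<Sum>x | x \<in> F \<and> h x = y. u x) *\<^sub>R y) = (\<Sum>y\<in>B. \<Sum>x | x \<in> F \<and> h x = y. u x *\<^sub>R h x)"
    by (simp add: scaleR_left.sum)
  also have "\<dots> = (\<Sum>x\<in>F. u x *\<^sub>R h x)"
    by (rule sum.group) (use F \<open>finite B\<close> in auto)
  also have "\<dots> = (\<Sum>x\<in>E. u x *\<^sub>R h x)"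
    using \<open>finite E\<close> by (intro sum.mono_neutral_left) (auto simp: F_def)
  finally have "(\<Sum>y\<in>B. (\<Sum>x | x \<in> F \<and> h x = y. u x) *\<^sub>R y) = (\<Sum>x\<in>E. u x *\<^sub>R h x)" .
  moreover have "(\<Sum>y\<in>B. \<Sum>x | x \<in> F \<and> h x = y. u x) = 1"
  proof -
    have "(\<Sum>y\<in>B. \<Sum>x | x \<in> F \<and> h x = y. u x) = sum u F"
      by (rule sum.group) (use F \<open>finite B\<close> in auto)
    also have "\<dots> = sum u E"
      using \<open>finite E\<close> by (intro sum.mono_neutral_left) (auto simp: F_def)
    finally show ?thesis
      using u by (simp add: bary_def)
  qed
  moreover have "(\<Sum>x | x \<in> F \<and> h x = y. u x) = 0" if "y \<notin> B" for y
    using F that by (intro sum.neutral) auto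
  ultimately show ?thesis
    using u unfolding bary_def restr by (auto intro: sum_nonneg)
qed

section \<open>Barycentric form of the face-to-face condition\<close>

lemma vertices_subset: "vertices S \<subseteq> S"
  by (auto simp: vertices_def extreme_point_of_def)

lemma vertices_convex_hull:
  "\<not> affine_dependent C \<Longrightarrow> vertices (convex hull C) = C"
  by (simp add: vertices_def extreme_point_of_convex_hull_affine_independent)

lemma simplexD:
  assumes "n simplex S"
  shows "\<not> affine_dependent (vertices S)" "finite (vertices S)" "int (card (vertices S)) = n + 1"
    "S = convex hull vertices S"
  using assms vertices_convex_hull unfolding simplex by metis+

text \<open>A face of a simplex is spanned by some of its vertices; coordinates on these are, by
  uniqueness, the coordinates in the simplex.\<close>

lemma face_bary_support:
  fixes C :: "'v::euclidean_space set"
  assumes indep: "\<not> affine_dependent C" and F: "F face_of convex hull C"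
    and u: "bary C u z" and z: "z \<in> F"
  shows "bary (C \<inter> F) u z"
proof -
  obtain B where B: "B \<subseteq> C" "F = convex hull B"
    using F face_of_convex_hull_affine_independent[OF indep] by blast
  have fin: "finite C" "finite B"
    using indep aff_independent_finite B finite_subset by blast+
  obtain v where "bary B v z"
    using z B convex_hull_bary[OF fin(2)] by blast
  moreover from this have "u = v"
    using bary_unique[OF indep fin(1) u] bary_mono B fin by blast
  ultimately have "bary B u z" by simp
  moreover have "B \<subseteq> C \<inter> F"
    using B hull_subset[of B convex] by blast
  ultimately show ?thesis
    using bary_mono fin(1) by blast
qed

text \<open>Both coordinate functions live on the vertices of the common face
  \<open>S \<inter> S'\<close>, where they are unique. In this form the face-to-face condition on
  \<open>T0\<close> and \<open>TQ\<close> enters the construction.\<close>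

lemma triangulation_bary_unique:
  assumes T: "triangulation_of T P" and S: "S \<in> T" "S' \<in> T"
    and u: "bary (vertices S) u z" and v: "bary (vertices S') v z"
  shows "u = v"
proof -
  have full: "aff_dim P simplex S" "aff_dim P simplex S'"
    using T S by (auto simp: triangulation_of_def)
  note V = simplexD[OF full(1)] and V' = simplexD[OF full(2)]
  let ?F = "S \<inter> S'"
  have F: "?F face_of S" "?F face_of S'"
    using T S unfolding triangulation_of_def triangulation_def by (blast, metis Int_commute)
  have z: "z \<in> ?F"
    using u v V V' convex_hull_bary by (metis IntI)
  have sub: "vertices S \<inter> ?F = vertices S' \<inter> ?F"
    using F V(4) V'(4) extreme_point_of_face unfolding vertices_def by blast
  have "bary (vertices S \<inter> ?F) u z"
    using face_bary_support[OF V(1) _ u z] F V(4) by simp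
  moreover have "bary (vertices S' \<inter> ?F) v z"
    using face_bary_support[OF V'(1) _ v z] F V'(4) by simp
  ultimately show ?thesis
    using sub bary_unique[of "vertices S \<inter> ?F"] V(1,2) affine_independent_subset
    by (metis finite_Int inf_le1)
qed

text \<open>By Radon's theorem a dependent set has two disjoint subsets whose hulls meet; a common
  point has coordinates with disjoint supports.\<close>

lemma affine_independent_if_bary_unique:
  fixes A :: "'v::euclidean_space set"
  assumes "finite A" and uniq: "\<And>u v z. bary A u z \<Longrightarrow> bary A v z \<Longrightarrow> u = v"
  shows "\<not> affine_dependent A"
proof
  assume "affine_dependent A"
  then obtain M N z where MN: "M \<inter> N = {}" "M \<union> N = A" "z \<in> convex hull M" "z \<in> convex hull N"
    using Radon_partition[OF assms(1)] by blast
  then have fin: "finite M" "finite N"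
    using assms(1) by auto
  obtain u v where uv: "bary M u z" "bary N v z"
    using MN convex_hull_bary fin by metis
  then have "u = v"
    using uniq bary_mono MN assms(1) by (metis Un_upper1 Un_upper2)
  then have "u x = 0" for x
    using uv MN(1) unfolding bary_def by (metis disjoint_iff)
  then show False
    using uv(1) by (simp add: bary_def)
qed

text \<open>A converse to \<open>triangulation_bary_unique\<close>: shared coordinates are supported
  on \<open>A \<inter> B\<close>, so two hulls meet in the hull of \<open>A \<inter> B\<close>, a
  face of both. The case \<open>A = B\<close> gives affine independence.\<close>

lemma triangulation_convex_hulls:
  fixes \<C> :: "'v::euclidean_space set set"
  assumes "finite \<C>" and fin: "\<And>A. A \<in> \<C> \<Longrightarrow> finite A"
    and uniq: "\<And>A B u v z. A \<in> \<C> \<Longrightarrow> B \<in> \<C> \<Longrightarrow> bary A u z \<Longrightarrow> bary B v z \<Longrightarrow> u = v"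
  shows "triangulation ((hull) convex ` \<C>)"
proof -
  have indep: "\<not> affine_dependent A" if "A \<in> \<C>" for A
    by (rule affine_independent_if_bary_unique[OF fin[OF that] uniq[OF that that]])
  have face: "convex hull A \<inter> convex hull B face_of convex hull A" if AB: "A \<in> \<C>" "B \<in> \<C>" for A B
  proof -
    have "convex hull A \<inter> convex hull B \<subseteq> convex hull (A \<inter> B)"
    proof
      fix z assume "z \<in> convex hull A \<inter> convex hull B"
      then obtain u v where uv: "bary A u z" "bary B v z"
        using convex_hull_bary fin AB by (metis IntD1 IntD2)
      have "u = v"
        by (rule uniq[OF AB uv])
      then have "u x \<noteq> 0 \<Longrightarrow> x \<in> A \<inter> B" for x
        using uv by (auto simp: bary_def)
      then have "bary (A \<inter> B) u z"
        using bary_restrict[OF uv(1) fin[OF AB(1)]] by blast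
      then show "z \<in> convex hull (A \<inter> B)"
        using convex_hull_bary fin AB by (metis finite_Int)
    qed
    then have "convex hull A \<inter> convex hull B = convex hull (A \<inter> B)"
      using hull_mono[of "A \<inter> B" A convex] hull_mono[of "A \<inter> B" B convex] by auto
    then show ?thesis
      using face_of_convex_hull_affine_independent[OF indep[OF AB(1)]] by (metis inf_le1)
  qed
  have "\<exists>n. n simplex (convex hull A)" if "A \<in> \<C>" for A
    using indep[OF that] simplex_convex_hull[of A "int (card A) - 1"] by auto
  then show ?thesis
    using assms(1) face unfolding triangulation_def by (auto simp: Int_commute)
qed

text \<open>A nonempty relatively open part of \<open>S\<close> has the dimension of
  \<open>S\<close>, so no single \<open>K\<close> contains it. Removing the closed sets one at a
  time keeps it relatively open and nonempty.\<close>

lemma convex_Int_open_not_covered: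
  fixes S :: "'v::euclidean_space set"
  assumes "finite F" "convex S" "\<And>K. K \<in> F \<Longrightarrow> closed K \<and> aff_dim K < aff_dim S"
    and "open U" "S \<inter> U \<noteq> {}"
  shows "\<not> S \<inter> U \<subseteq> \<Union>F"
  using assms
proof (induction F arbitrary: U rule: finite_induct)
  case (insert K F)
  have "S \<inter> (U \<inter> - K) \<noteq> {}"
  proof
    assume "S \<inter> (U \<inter> - K) = {}"
    then have "aff_dim (S \<inter> U) \<le> aff_dim K"
      by (intro aff_dim_subset) auto
    then show False
      using aff_dim_convex_Int_open[OF \<open>convex S\<close> insert.prems(3,4)] insert.prems(2) by force
  qed
  moreover have "open (U \<inter> - K)"
    using insert.prems by (simp add: open_Int open_Compl)
  ultimately have "\<not> S \<inter> (U \<inter> - K) \<subseteq> \<Union>F"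
    using insert by blast
  then show ?case by auto
qed auto

text \<open>A gap left by the full-dimensional pieces would be relatively open in \<open>S\<close>,
  and the remaining pieces cannot fill it.\<close>

lemma convex_covered_by_full_dim:
  fixes S :: "'v::euclidean_space set"
  assumes "finite F" "convex S" "\<And>K. K \<in> F \<Longrightarrow> closed K" "S \<subseteq> \<Union>F"
  shows "S \<subseteq> \<Union>{K \<in> F. aff_dim S \<le> aff_dim K}"
proof (rule ccontr)
  let ?G = "\<Union>{K \<in> F. aff_dim S \<le> aff_dim K}"
  assume "\<not> S \<subseteq> ?G"
  moreover have "closed ?G"
    using assms by (intro closed_Union) auto
  ultimately have "\<not> S \<inter> - ?G \<subseteq> \<Union>{K \<in> F. \<not> aff_dim S \<le> aff_dim K}"
    using assms by (intro convex_Int_open_not_covered) auto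
  then show False
    using assms(4) by blast
qed

section \<open>Dimension and vertices of products\<close>

lemma dim_Times_zero:
  fixes A :: "'a::euclidean_space set" and B :: "'b::euclidean_space set"
  assumes "0 \<in> A" "0 \<in> B"
  shows "dim (A \<times> B) = dim A + dim B"
proof -
  have 1: "(\<lambda>x. (x, 0)) ` span A \<subseteq> span (A \<times> B)"
  proof -
    have "linear (\<lambda>x::'a. (x, 0::'b))"
      by (simp add: linear_iff)
    then have "(\<lambda>x. (x, 0)) ` span A = span ((\<lambda>x. (x, 0::'b)) ` A)"
      by (simp add: linear_span_image)
    also have "\<dots> \<subseteq> span (A \<times> B)"
      using assms by (intro span_mono) auto
    finally show ?thesis .
  qed
  have 2: "(\<lambda>x. (0, x)) ` span B \<subseteq> span (A \<times> B)"
  proof -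
    have "linear (\<lambda>x::'b. (0::'a, x))"
      by (simp add: linear_iff)
    then have "(\<lambda>x. (0, x)) ` span B = span ((\<lambda>x. (0::'a, x)) ` B)"
      by (simp add: linear_span_image)
    also have "\<dots> \<subseteq> span (A \<times> B)"
      using assms by (intro span_mono) auto
    finally show ?thesis .
  qed
  have "span A \<times> span B \<subseteq> span (A \<times> B)"
  proof
    fix z assume "z \<in> span A \<times> span B"
    then have "(fst z, 0) \<in> span (A \<times> B)" "(0, snd z) \<in> span (A \<times> B)"
      using 1 2 by auto
    then have "(fst z, 0) + (0, snd z) \<in> span (A \<times> B)"
      by (rule span_add)
    then show "z \<in> span (A \<times> B)" by simp
  qed
  then have "dim (span A \<times> span B) \<le> dim (A \<times> B)"
    by (metis dim_span dim_subset)
  moreover have "dim (A \<times> B) \<le> dim (span A \<times> span B)"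
    by (intro dim_subset) (auto intro: span_base)
  ultimately show ?thesis
    by (simp add: dim_Times)
qed

lemma aff_dim_Times:
  fixes A :: "'a::euclidean_space set" and B :: "'b::euclidean_space set"
  assumes "A \<noteq> {}" "B \<noteq> {}"
  shows "aff_dim (A \<times> B) = aff_dim A + aff_dim B"
proof -
  obtain a b where ab: "a \<in> A" "b \<in> B"
    using assms by blast
  have "(\<lambda>z. z - (a, b)) ` (A \<times> B) = (\<lambda>x. x - a) ` A \<times> (\<lambda>x. x - b) ` B"
    by (auto simp: image_iff)
  then show ?thesis
    using ab aff_dim_eq_dim_subtract[of a A] aff_dim_eq_dim_subtract[of b B]
      aff_dim_eq_dim_subtract[of "(a, b)" "A \<times> B"] dim_Times_zero[of "(\<lambda>x. x - a) ` A" "(\<lambda>x. x - b) ` B"]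
    by (force simp: hull_inc)
qed

lemma vertices_Times:
  fixes A :: "'a::euclidean_space set" and B :: "'b::euclidean_space set"
  shows "vertices (A \<times> B) = vertices A \<times> vertices B"
proof -
  have "{(x, y)} face_of A \<times> B \<longleftrightarrow> {x} face_of A \<and> {y} face_of B" for x y
    using face_of_Times_eq[of "{x}" "{y}" A B] by simp
  then show ?thesis
    by (auto simp: vertices_def face_of_singleton)
qed

lemma polytope_vertices:
  assumes "polytope P"
  shows "finite (vertices P)" "P = convex hull vertices P"
proof -
  show "finite (vertices P)"
    using finite_polyhedron_extreme_points[OF polytope_imp_polyhedron[OF assms]]
    by (simp add: vertices_def)
  show "P = convex hull vertices P"
    using assms Krein_Milman_Minkowski polytope_imp_compact polytope_imp_convex
    unfolding vertices_def by blast
qed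

section \<open>Triangulating the product\<close>

definition staircases ::
  "('x \<Rightarrow> nat) \<Rightarrow> ('w \<Rightarrow> nat) \<Rightarrow> ('w \<Rightarrow> 'c) \<Rightarrow> ('x \<times> 'c) set \<Rightarrow> 'w set \<Rightarrow> ('x \<times> 'w) set set" where
  "staircases f g c V W = {A. A \<subseteq> {(x, w). w \<in> W \<and> (x, c w) \<in> V} \<and>
     (\<forall>v. noncrossing f g {(x, w) \<in> A. c w = v})}"

lemma finite_fibre:
  assumes "finite V"
  shows "finite {x. (x, v) \<in> V}"
proof -
  have "{x. (x, v) \<in> V} \<subseteq> fst ` V" by force
  then show ?thesis
    using assms finite_subset by blast
qed

text \<open>\<open>N\<close> adds up the largest staircase sizes of all colours, so a set of this
  size is maximal in every colour class. Its classes determine it, and the path counts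
  multiply.\<close>

lemma card_staircases_le:
  fixes c :: "'w \<Rightarrow> 'c"
  assumes "finite V" "finite W" "finite C" "c ` W \<subseteq> C"
    and f: "inj_on f (fst ` V)" and g: "inj_on g W"
    and ne: "\<And>v. v \<in> C \<Longrightarrow> {x. (x, v) \<in> V} \<noteq> {}"
    and N: "N = (\<Sum>v\<in>C. card {x. (x, v) \<in> V} - 1 + card {w \<in> W. c w = v})"
  shows "real (card {A \<in> staircases f g c V W. card A = N}) \<le>
    (\<Prod>v\<in>C. pochhammer (real (card {w \<in> W. c w = v})) (card {x. (x, v) \<in> V} - 1)
      / fact (card {x. (x, v) \<in> V} - 1))"
proof -
  define X where "X v = {x. (x, v) \<in> V}" for v
  define Y where "Y v = {w \<in> W. c w = v}" for v
  define M where "M v = {B. B \<subseteq> X v \<times> Y v \<and> noncrossing f g B \<and> card B = card (X v) - 1 + card (Y v)}" for v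
  define \<Phi> where "\<Phi> A = (\<lambda>v\<in>C. {(x, w) \<in> A. c w = v})" for A :: "('a \<times> 'w) set"
  let ?F = "{A \<in> staircases f g c V W. card A = N}"
  have fin: "finite (X v)" "finite (Y v)" for v
    using finite_fibre assms(1,2) by (auto simp: X_def Y_def)
  have inj: "inj_on f (X v)" "inj_on g (Y v)" for v
    using f g by (auto simp: X_def Y_def inj_on_def)
  have finM: "finite (M v)" for v
    by (rule finite_subset[of _ "Pow (X v \<times> Y v)"]) (use fin in \<open>auto simp: M_def\<close>)
  have "inj_on \<Phi> ?F"
  proof (rule inj_onI)
    fix A B assume AB: "A \<in> ?F" "B \<in> ?F" "\<Phi> A = \<Phi> B"
    have "D = (\<Union>v\<in>C. \<Phi> D v)" if "D \<in> ?F" for D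
      using that assms(4) by (fastforce simp: \<Phi>_def staircases_def)
    then show "A = B"
      using AB by metis
  qed
  moreover have "\<Phi> ` ?F \<subseteq> PiE C M"
  proof
    fix z assume "z \<in> \<Phi> ` ?F"
    then obtain A where A: "A \<in> staircases f g c V W" "card A = N" and z: "z = \<Phi> A"
      by blast
    let ?A = "\<lambda>v. {(x, w) \<in> A. c w = v}"
    have sub: "?A v \<subseteq> X v \<times> Y v" for v
      using A(1) by (auto simp: staircases_def X_def Y_def)
    have nc: "noncrossing f g (?A v)" for v
      using A(1) by (auto simp: staircases_def)
    have le: "card (?A v) \<le> card (X v) - 1 + card (Y v)" if "v \<in> C" for v
      by (rule card_noncrossing_le[OF fin(1) _ fin(2) inj nc sub])
        (use ne[OF that] in \<open>simp add: X_def\<close>)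
    have img: "(\<lambda>z. c (snd z)) ` A \<subseteq> C"
      using A(1) assms(4) by (fastforce simp: staircases_def)
    have "A \<subseteq> fst ` V \<times> W"
      using A(1) by (force simp: staircases_def)
    then have finA: "finite A"
      using assms(1,2) finite_subset by blast
    have eq: "?A v = {z \<in> A. c (snd z) = v}" for v
      by auto
    have "(\<Sum>v\<in>C. card (?A v)) = card A"
      using sum.group[OF finA assms(3) img, of "\<lambda>_. 1::nat"] unfolding eq by simp
    then have "(\<Sum>v\<in>C. card (?A v)) = (\<Sum>v\<in>C. card (X v) - 1 + card (Y v))"
      using A(2) N by (simp add: X_def Y_def)
    then have "card (?A v) = card (X v) - 1 + card (Y v)" if "v \<in> C" for v
      using sum_mono_inv[of "\<lambda>v. card (?A v)" C "\<lambda>v. card (X v) - 1 + card (Y v)" v] le that assms(3)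
      by blast
    then show "z \<in> PiE C M"
      using sub nc by (auto simp: z \<Phi>_def M_def)
  qed
  ultimately have "card ?F \<le> card (PiE C M)"
    using finM assms(3) by (intro card_inj_on_le[of \<Phi>] finite_PiE) auto
  also have "\<dots> = (\<Prod>v\<in>C. card (M v))"
    by (rule card_PiE[OF assms(3)])
  finally have "real (card ?F) \<le> real (\<Prod>v\<in>C. card (M v))"
    by (simp only: of_nat_le_iff)
  also have "\<dots> = (\<Prod>v\<in>C. real (card (M v)))"
    by simp
  also have "\<dots> \<le> (\<Prod>v\<in>C. pochhammer (real (card (Y v))) (card (X v) - 1) / fact (card (X v) - 1))"
    unfolding M_def
    by (intro prod_mono conjI card_maximal_noncrossing_le fin inj) (use ne in \<open>auto simp: X_def\<close>)
  finally show ?thesis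
    by (simp add: X_def Y_def)
qed

lemma sum_fst_fibre:
  assumes "x \<in> F"
  shows "(\<Sum>e | e \<in> F \<times> G \<and> (fst e, c (snd e)) = (x, v). h e) = (\<Sum>w | w \<in> G \<and> c w = v. h (x, w))"
  by (rule sum.reindex_bij_witness[of _ "\<lambda>w. (x, w)" snd]) (use assms in auto)

lemma sum_snd_fibre:
  assumes "w \<in> G"
  shows "(\<Sum>e | e \<in> F \<times> G \<and> snd e = w. h e) = (\<Sum>x\<in>F. h (x, w))"
  by (rule sum.reindex_bij_witness[of _ "\<lambda>x. (x, w)" fst]) (use assms in auto)

lemma simplex_type_eq: "simplex_type R v = card {x. (x, v) \<in> vertices R} - 1"
proof -
  have "card {e \<in> vertices R. snd e = v} = card {x. (x, v) \<in> vertices R}"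
    by (rule bij_betw_same_card[of fst], rule bij_betw_byWitness[of _ "\<lambda>x. (x, v)"]) auto
  then show ?thesis
    by (simp add: simplex_type_def)
qed

text \<open>Without a vertex over \<open>v\<close>, all vertices would lie in a set of dimension at
  most \<open>l + m - 2\<close>, one too small. With all \<open>m\<close> fibres nonempty, the
  \<open>l + m\<close> vertices give types of sum \<open>l\<close>.\<close>

lemma full_simplex_Times:
  fixes P :: "'a::euclidean_space set" and D :: "'c::euclidean_space set"
  assumes P: "aff_dim P = int l" and D: "(int m - 1) simplex D" and m: "0 < m"
    and simR: "aff_dim (P \<times> D) simplex R" and R: "vertices R \<subseteq> vertices (P \<times> D)"
  shows "v \<in> vertices D \<Longrightarrow> {x. (x, v) \<in> vertices R} \<noteq> {}"
    and "(\<Sum>v\<in>vertices D. simplex_type R v) = l"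
proof -
  let ?C = "vertices D"
  have finC: "finite ?C" and cC: "card ?C = m" and aD: "aff_dim D = int m - 1"
    using simplexD[OF D] aff_dim_simplex[OF D] by auto
  have ne: "P \<noteq> {}" "D \<noteq> {}"
    using P aD m by auto
  note V = simplexD[OF simR]
  have cR: "card (vertices R) = l + m"
    using V(3) aff_dim_Times[OF ne] P aD by simp
  have RC: "vertices R \<subseteq> P \<times> ?C"
    using R vertices_subset[of P] unfolding vertices_Times by blast
  have fib: "{x. (x, v) \<in> vertices R} \<noteq> {}" if v: "v \<in> ?C" for v
  proof
    assume "{x. (x, v) \<in> vertices R} = {}"
    then have sub: "vertices R \<subseteq> P \<times> (?C - {v})"
      using RC by auto
    moreover have "vertices R \<noteq> {}"
      using cR m by auto
    ultimately have "?C - {v} \<noteq> {}"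
      by auto
    from aff_dim_Times[OF ne(1) this] have "aff_dim (P \<times> (?C - {v})) = int l + aff_dim (?C - {v})"
      using P by simp
    moreover have "aff_dim (?C - {v}) \<le> int m - 2"
      using aff_dim_le_card[of "?C - {v}"] finC v cC m by (simp add: of_nat_diff)
    moreover have "aff_dim (vertices R) = int (l + m) - 1"
      using V(1) cR by (simp add: affine_independent_iff_card)
    ultimately show False
      using aff_dim_subset[OF sub] by simp
  qed
  then show "v \<in> ?C \<Longrightarrow> {x. (x, v) \<in> vertices R} \<noteq> {}" .
  have "card {e \<in> vertices R. snd e = v} = simplex_type R v + 1" if v: "v \<in> ?C" for v
  proof -
    obtain x where "(x, v) \<in> vertices R"
      using fib[OF v] by blast
    then have "{e \<in> vertices R. snd e = v} \<noteq> {}"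
      by force
    moreover have "finite {e \<in> vertices R. snd e = v}"
      using V(2) by simp
    ultimately have "card {e \<in> vertices R. snd e = v} > 0"
      unfolding card_gt_0_iff by blast
    then show ?thesis
      by (simp add: simplex_type_def)
  qed
  moreover have "(\<Sum>v\<in>?C. \<Sum>e | e \<in> vertices R \<and> snd e = v. 1) = (\<Sum>e\<in>vertices R. 1::nat)"
    by (rule sum.group) (use RC V(2) finC in auto)
  ultimately have "(\<Sum>v\<in>?C. simplex_type R v + 1) = l + m"
    using cR by simp
  then show "(\<Sum>v\<in>?C. simplex_type R v) = l"
    by (simp only: sum.distrib) (simp add: cC)
qed

section \<open>Cells for a fixed colouring of the vertices of \<open>Q\<close>\<close>

locale coloured_triangulation =
  fixes P :: "'a::euclidean_space set" and Q :: "'b::euclidean_space set"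
    and D :: "'c::euclidean_space set" and T0 :: "('a \<times> 'c) set set" and TQ :: "'b set set"
    and k :: int and c :: "'b \<Rightarrow> 'c" and f :: "'a \<Rightarrow> nat" and g :: "'b \<Rightarrow> nat"
  assumes polyP: "polytope P" and polyQ: "polytope Q" and simD: "k simplex D"
    and T0: "triangulation_of T0 (P \<times> D)" and TQ: "triangulation_of TQ Q"
    and c: "\<And>w. w \<in> vertices Q \<Longrightarrow> c w \<in> vertices D"
    and f: "inj_on f (vertices P)" and g: "inj_on g (vertices Q)"
begin

definition cells :: "('a \<times> 'b) set set" where
  "cells = (\<Union>S\<in>TQ. \<Union>R\<in>T0. staircases f g c (vertices R) (vertices S))"

abbreviation "F \<equiv> vertices P"
abbreviation "G \<equiv> vertices Q"
abbreviation "C \<equiv> vertices D"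
abbreviation "Gc v \<equiv> {w \<in> G. c w = v}"

text \<open>The sums of both marginals run over \<open>F \<times> G\<close> rather than over one
  cell, so that different cells can be compared. They push coordinates forward to \<open>Q\<close>
  and along the map from \<open>(x, w)\<close> to \<open>(x, c w)\<close>.\<close>

definition marginal_Q :: "('a \<times> 'b \<Rightarrow> real) \<Rightarrow> 'b \<Rightarrow> real" where
  "marginal_Q u w = (\<Sum>e | e \<in> F \<times> G \<and> snd e = w. u e)"

definition marginal_PD :: "('a \<times> 'b \<Rightarrow> real) \<Rightarrow> 'a \<times> 'c \<Rightarrow> real" where
  "marginal_PD u y = (\<Sum>e | e \<in> F \<times> G \<and> (fst e, c (snd e)) = y. u e)"

lemma finF: "finite F" and finG: "finite G" and finC: "finite C"
  using polytope_vertices polyP polyQ simplexD(2)[OF simD] by auto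

lemma vertices_T0: "R \<in> T0 \<Longrightarrow> vertices R \<subseteq> F \<times> C"
  using T0 by (auto simp: triangulation_of_def simp flip: vertices_Times)

lemma vertices_TQ: "S \<in> TQ \<Longrightarrow> vertices S \<subseteq> G"
  using TQ by (auto simp: triangulation_of_def)

lemma finite_vertices_T0: "R \<in> T0 \<Longrightarrow> finite (vertices R)"
  using vertices_T0 finF finC finite_subset by blast

lemma finite_vertices_TQ: "S \<in> TQ \<Longrightarrow> finite (vertices S)"
  using vertices_TQ finG finite_subset by blast

lemma cells_subset: "A \<in> cells \<Longrightarrow> A \<subseteq> F \<times> G"
  unfolding cells_def staircases_def using vertices_T0 vertices_TQ by blast

lemma finite_cells: "finite cells"
  by (rule finite_subset[of _ "Pow (F \<times> G)"]) (use cells_subset finF finG in auto)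

lemma finite_cell: "A \<in> cells \<Longrightarrow> finite A"
  using cells_subset finF finG finite_subset by blast

text \<open>Both marginals are push-forwards. The resulting point of \<open>P \<times> D\<close>
  depends on \<open>u\<close> only through \<open>marginal_Q u\<close>, and inside each colour class
  \<open>u\<close> is a noncrossing coupling of the two marginals.\<close>

lemma cell_marginals:
  assumes A: "A \<in> staircases f g c (vertices R) (vertices S)" and RS: "R \<in> T0" "S \<in> TQ"
    and u: "bary A u z"
  shows "bary (vertices S) (marginal_Q u) (snd z)"
    "bary (vertices R) (marginal_PD u) (fst z, \<Sum>w\<in>G. marginal_Q u w *\<^sub>R c w)"
    "coupling F (Gc v) (\<lambda>x. marginal_PD u (x, v)) (marginal_Q u) u"
    "noncrossing f g {e \<in> F \<times> Gc v. u e \<noteq> 0}"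
proof -
  have "A \<in> cells"
    using A RS by (auto simp: cells_def)
  then have AE: "A \<subseteq> F \<times> G"
    by (rule cells_subset)
  have finE: "finite (F \<times> G)"
    using finF finG by simp
  have uE: "bary (F \<times> G) u z"
    using bary_mono[OF u AE finE] .
  have suppA: "e \<in> A" if "u e \<noteq> 0" for e
    using bary_support[OF u that] .
  have z: "(\<Sum>e\<in>F \<times> G. u e *\<^sub>R e) = z"
    using uE by (simp add: bary_def)
  have "bary (vertices S) (marginal_Q u) (\<Sum>e\<in>F \<times> G. u e *\<^sub>R snd e)"
    unfolding marginal_Q_def
    by (rule bary_pushforward[OF uE finE finite_vertices_TQ[OF RS(2)]])
      (use suppA A in \<open>force simp: staircases_def\<close>)
  also have "(\<Sum>e\<in>F \<times> G. u e *\<^sub>R snd e) = snd z"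
    by (simp add: snd_sum flip: z)
  finally show "bary (vertices S) (marginal_Q u) (snd z)" .
  have "bary (vertices R) (marginal_PD u) (\<Sum>e\<in>F \<times> G. u e *\<^sub>R (fst e, c (snd e)))"
    unfolding marginal_PD_def
    by (rule bary_pushforward[OF uE finE finite_vertices_T0[OF RS(1)]])
      (use suppA A in \<open>force simp: staircases_def\<close>)
  also have "(\<Sum>e\<in>F \<times> G. u e *\<^sub>R (fst e, c (snd e))) = (fst z, \<Sum>w\<in>G. marginal_Q u w *\<^sub>R c w)"
  proof (rule prod_eqI)
    have "(\<Sum>e\<in>F \<times> G. u e *\<^sub>R c (snd e)) = (\<Sum>w\<in>G. \<Sum>e | e \<in> F \<times> G \<and> snd e = w. u e *\<^sub>R c (snd e))"
      by (rule sum.group[symmetric]) (use finE finG in auto)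
    also have "\<dots> = (\<Sum>w\<in>G. marginal_Q u w *\<^sub>R c w)"
      by (simp add: marginal_Q_def scaleR_left.sum)
    finally show "snd (\<Sum>e\<in>F \<times> G. u e *\<^sub>R (fst e, c (snd e))) =
        snd (fst z, \<Sum>w\<in>G. marginal_Q u w *\<^sub>R c w)"
      by (simp add: snd_sum)
  qed (simp add: fst_sum flip: z)
  finally show "bary (vertices R) (marginal_PD u) (fst z, \<Sum>w\<in>G. marginal_Q u w *\<^sub>R c w)" .
  show "coupling F (Gc v) (\<lambda>x. marginal_PD u (x, v)) (marginal_Q u) u"
    using uE by (auto simp: coupling_def marginal_PD_def marginal_Q_def sum_fst_fibre sum_snd_fibre
        bary_def simp del: prod.inject mem_Sigma_iff)
  have "noncrossing f g {(x, w) \<in> A. c w = v}"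
    using A by (simp add: staircases_def)
  then show "noncrossing f g {e \<in> F \<times> Gc v. u e \<noteq> 0}"
    by (rule noncrossing_subset) (use suppA in auto)
qed

lemma cells_bary_unique:
  assumes A: "A \<in> cells" "A' \<in> cells" and u: "bary A u z" "bary A' u' z"
  shows "u = u'"
proof
  fix e
  obtain R S where RS: "R \<in> T0" "S \<in> TQ" "A \<in> staircases f g c (vertices R) (vertices S)"
    using A by (auto simp: cells_def)
  obtain R' S' where RS': "R' \<in> T0" "S' \<in> TQ" "A' \<in> staircases f g c (vertices R') (vertices S')"
    using A by (auto simp: cells_def)
  note m = cell_marginals[OF RS(3,1,2) u(1)]
  note m' = cell_marginals[OF RS'(3,1,2) u(2)]
  have Q: "marginal_Q u = marginal_Q u'"
    using triangulation_bary_unique[OF TQ RS(2) RS'(2) m(1) m'(1)] .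
  \<comment> \<open>Only now are the two points of \<open>P \<times> D\<close> known to coincide,
    since their second components are computed from the marginals on \<open>Q\<close>.\<close>
  have PD: "marginal_PD u = marginal_PD u'"
    using triangulation_bary_unique[OF T0 RS(1) RS'(1) m(2)] m'(2) Q by simp
  show "u e = u' e"
  proof (cases "e \<in> F \<times> G")
    case True
    then have "e \<in> F \<times> Gc (c (snd e))"
      by auto
    then show ?thesis
      by (rule noncrossing_coupling_unique[OF finF _ f _ m(3,4), rotated -1])
        (use m'(3,4) finG Q PD g in \<open>auto intro: inj_on_subset\<close>)
  next
    case False
    then show ?thesis
      using u cells_subset A unfolding bary_def by (metis subsetD)
  qed
qed

text \<open>The reverse of \<open>cell_marginals\<close>: both marginals are read off from
  \<open>TQ\<close> and \<open>T0\<close>, and the northwest corner rule couples them colour by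
  colour.\<close>

lemma cells_cover: "P \<times> Q \<subseteq> (\<Union>A\<in>cells. convex hull A)"
proof (rule subsetI, clarify)
  fix p q assume p: "p \<in> P" and q: "q \<in> Q"
  have simD': "\<not> affine_dependent C" "D = convex hull C"
    using simplexD[OF simD] by auto
  obtain S where S: "S \<in> TQ" "q \<in> S"
    using TQ q by (auto simp: triangulation_of_def)
  have "S = convex hull vertices S"
    using TQ S simplexD(4) by (auto simp: triangulation_of_def)
  then obtain l where l: "bary (vertices S) l q"
    using S convex_hull_bary[OF finite_vertices_TQ] by metis
  then have lG: "bary G l q"
    using bary_mono vertices_TQ S finG by blast
  \<comment> \<open>The image of \<open>q\<close> under the affine extension of the colouring to
    \<open>S\<close>.\<close>
  define d where "d = (\<Sum>w\<in>G. l w *\<^sub>R c w)"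
  have d: "bary C (\<lambda>v. \<Sum>w | w \<in> G \<and> c w = v. l w) d"
    unfolding d_def by (rule bary_pushforward[OF lG finG finC c])
  then have "d \<in> D"
    using simD' convex_hull_bary[OF finC] by blast
  then obtain R where R: "R \<in> T0" "(p, d) \<in> R"
    using T0 p by (fastforce simp: triangulation_of_def)
  have "R = convex hull vertices R"
    using T0 R simplexD(4) by (auto simp: triangulation_of_def)
  then obtain m where m: "bary (vertices R) m (p, d)"
    using R convex_hull_bary[OF finite_vertices_T0] by metis
  have finFC: "finite (F \<times> C)"
    using finF finC by simp
  have mFC: "bary (F \<times> C) m (p, d)"
    using bary_mono[OF m vertices_T0[OF R(1)] finFC] .
  then have pd: "(\<Sum>e\<in>F \<times> C. m e *\<^sub>R e) = (p, d)"
    by (simp add: bary_def)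
  have "bary C (\<lambda>v. \<Sum>e | e \<in> F \<times> C \<and> snd e = v. m e) (\<Sum>e\<in>F \<times> C. m e *\<^sub>R snd e)"
    using mFC by (intro bary_pushforward[OF mFC finFC finC]) (auto simp: bary_def)
  also have "(\<Sum>e\<in>F \<times> C. m e *\<^sub>R snd e) = d"
    using arg_cong[OF pd, of snd] by (simp add: snd_sum)
  \<comment> \<open>Both sides are the coordinates of \<open>d\<close> in the simplex
    \<open>D\<close>; hence in each colour the two marginals have the same total mass, as a coupling
    requires.\<close>
  finally have eq: "(\<lambda>v. \<Sum>e | e \<in> F \<times> C \<and> snd e = v. m e) = (\<lambda>v. \<Sum>w | w \<in> G \<and> c w = v. l w)"
    using bary_unique[OF simD'(1) finC _ d] by blast
  then have marg: "(\<Sum>x\<in>F. m (x, v)) = (\<Sum>w\<in>Gc v. l w)" if "v \<in> C" for v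
    using fun_cong[OF eq, of v] sum_snd_fibre[OF that, of m F] by simp
  have l0: "l w \<ge> 0" and m0: "m e \<ge> 0" for w e
    using l m by (simp_all add: bary_nonneg)
  have "\<forall>v\<in>C. \<exists>K. coupling F (Gc v) (\<lambda>x. m (x, v)) l K \<and>
      noncrossing f g {z \<in> F \<times> Gc v. K z \<noteq> 0}"
    using finF finG f g l0 m0 marg
    by (intro ballI noncrossing_coupling_exists) (auto intro: inj_on_subset)
  from bchoice[OF this] obtain K where
    "\<forall>v\<in>C. coupling F (Gc v) (\<lambda>x. m (x, v)) l (K v) \<and>
      noncrossing f g {z \<in> F \<times> Gc v. K v z \<noteq> 0}"
    ..
  then have K: "coupling F (Gc v) (\<lambda>x. m (x, v)) l (K v)"
      "noncrossing f g {z \<in> F \<times> Gc v. K v z \<noteq> 0}" if "v \<in> C" for v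
    using that by blast+
  \<comment> \<open>Each pair uses the coupling of its own colour; the default 0 makes
    \<open>u\<close> vanish off \<open>F \<times> G\<close>, as \<open>bary\<close> demands.\<close>
  define u where "u = (\<lambda>(x, w). if x \<in> F \<and> w \<in> G then K (c w) (x, w) else 0)"
  have u0: "u e \<ge> 0" for e
    using K(1)[OF c] by (cases e) (auto simp: u_def coupling_def)
  have ul: "(\<Sum>x\<in>F. u (x, w)) = l w" if "w \<in> G" for w
  proof -
    have "(\<Sum>x\<in>F. K (c w) (x, w)) = l w"
      using K(1)[OF c[OF that]] that by (simp add: coupling_def)
    then show ?thesis
      using that by (simp add: u_def)
  qed
  have um: "(\<Sum>w\<in>Gc v. u (x, w)) = m (x, v)" if "x \<in> F" "v \<in> C" for x v
  proof -
    have "(\<Sum>w\<in>Gc v. K v (x, w)) = m (x, v)"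
      using K(1)[OF that(2)] that(1) by (simp add: coupling_def)
    moreover have "(\<Sum>w\<in>Gc v. u (x, w)) = (\<Sum>w\<in>Gc v. K v (x, w))"
      using that by (intro sum.cong) (auto simp: u_def)
    ultimately show ?thesis by simp
  qed
  have finE: "finite (F \<times> G)"
    using finF finG by simp
  have sum_snd: "(\<Sum>e\<in>F \<times> G. h e) = (\<Sum>w\<in>G. \<Sum>x\<in>F. h (x, w))" for h :: "'a \<times> 'b \<Rightarrow> 'z::comm_monoid_add"
    by (subst sum.swap) (simp add: sum.cartesian_product case_prod_unfold)
  have "sum u (F \<times> G) = 1"
    using lG by (simp add: sum_snd ul bary_def)
  moreover have "(\<Sum>e\<in>F \<times> G. u e *\<^sub>R e) = (p, q)"
  proof (rule prod_eqI)
    have "(\<Sum>e\<in>F \<times> G. u e *\<^sub>R snd e) = (\<Sum>w\<in>G. l w *\<^sub>R w)"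
      by (simp add: sum_snd ul flip: scaleR_left.sum)
    then show "snd (\<Sum>e\<in>F \<times> G. u e *\<^sub>R e) = snd (p, q)"
      using lG by (simp add: snd_sum bary_def)
    have "(\<Sum>w\<in>G. u (x, w)) = (\<Sum>v\<in>C. m (x, v))" if "x \<in> F" for x
    proof -
      have "(\<Sum>w\<in>G. u (x, w)) = (\<Sum>v\<in>C. \<Sum>w\<in>Gc v. u (x, w))"
        by (rule sum.group[symmetric]) (use finG finC c in auto)
      then show ?thesis
        using that by (simp add: um)
    qed
    then have "(\<Sum>e\<in>F \<times> G. u e *\<^sub>R fst e) = (\<Sum>x\<in>F. (\<Sum>v\<in>C. m (x, v)) *\<^sub>R x)"
      by (simp add: scaleR_left.sum[symmetric] sum.cartesian_product' cong: sum.cong)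
    also have "\<dots> = (\<Sum>e\<in>F \<times> C. m e *\<^sub>R fst e)"
      by (simp add: scaleR_left.sum sum.cartesian_product')
    also have "\<dots> = p"
      using arg_cong[OF pd, of fst] by (simp add: fst_sum)
    finally show "fst (\<Sum>e\<in>F \<times> G. u e *\<^sub>R e) = fst (p, q)"
      by (simp add: fst_sum)
  qed
  ultimately have uE: "bary (F \<times> G) u (p, q)"
    using u0 by (auto simp: bary_def u_def)
  define A where "A = {e \<in> F \<times> G. u e \<noteq> 0}"
  have bA: "bary A u (p, q)"
    by (rule bary_restrict[OF uE finE]) (auto simp: A_def u_def split: if_splits)
  \<comment> \<open>A positive entry makes both of its marginals positive, so \<open>w\<close> and
    \<open>(x, c w)\<close> lie in the supports of \<open>l\<close> and \<open>m\<close>.\<close>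
  have "(x, w) \<in> A \<Longrightarrow> w \<in> vertices S \<and> (x, c w) \<in> vertices R" for x w
  proof -
    assume "(x, w) \<in> A"
    then have xw: "x \<in> F" "w \<in> G" "u (x, w) > 0"
      using u0[of "(x, w)"] by (auto simp: A_def)
    have "u (x, w) \<le> (\<Sum>x\<in>F. u (x, w))"
      using xw finF u0 by (intro member_le_sum) auto
    then have "l w \<noteq> 0"
      using xw ul by auto
    moreover have "u (x, w) \<le> (\<Sum>w'\<in>Gc (c w). u (x, w'))"
      using xw finG u0 by (intro member_le_sum) auto
    then have "m (x, c w) \<noteq> 0"
      using xw um c by auto
    ultimately show ?thesis
      using bary_support[OF l] bary_support[OF m] by blast
  qed
  moreover have "noncrossing f g {(x, w) \<in> A. c w = v}" for v
  proof (cases "v \<in> C")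
    case True
    then show ?thesis
      by (rule noncrossing_subset[OF K(2)]) (auto simp: A_def u_def)
  next
    case False
    then have "c w \<noteq> v" if "(x, w) \<in> A" for x w
      using c that by (auto simp: A_def)
    then show ?thesis
      by (auto simp: noncrossing_def)
  qed
  ultimately have "A \<in> staircases f g c (vertices R) (vertices S)"
    by (auto simp: staircases_def)
  then have "A \<in> cells"
    using S R by (auto simp: cells_def)
  then show "(p, q) \<in> (\<Union>A\<in>cells. convex hull A)"
    using bA convex_hull_bary finite_cell by blast
qed

text \<open>If a simplex of \<open>TQ\<close> misses a colour, some of its cells are neither full-dimensional nor faces
  of full-dimensional cells. They can be dropped, because the full-dimensional cells alone cover
  \<open>P \<times> Q\<close> (lemma \<open>convex_covered_by_full_dim\<close>).\<close>

definition refinement :: "('a \<times> 'b) set set" where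
  "refinement = (hull) convex ` {A \<in> cells. int (card A) = aff_dim (P \<times> Q) + 1}"

lemma cell_affine_independent: "A \<in> cells \<Longrightarrow> \<not> affine_dependent A"
  by (rule affine_independent_if_bary_unique[OF finite_cell cells_bary_unique])

lemma triangulation_of_refinement: "triangulation_of refinement (P \<times> Q)"
proof -
  let ?M = "{A \<in> cells. int (card A) = aff_dim (P \<times> Q) + 1}"
  have tri: "triangulation refinement"
    unfolding refinement_def
    by (rule triangulation_convex_hulls)
      (use finite_cells finite_cell in \<open>auto intro: cells_bary_unique\<close>)
  have conv: "convex (P \<times> Q)"
    using polyP polyQ by (simp add: convex_Times polytope_imp_convex)
  have sub: "convex hull A \<subseteq> P \<times> Q" if "A \<in> cells" for A
  proof (rule hull_minimal[where S=convex, OF _ conv])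
    show "A \<subseteq> P \<times> Q"
      using cells_subset[OF that] vertices_subset[of P] vertices_subset[of Q] by blast
  qed
  have dim: "aff_dim (convex hull A) = int (card A) - 1" if "A \<in> cells" for A
    using cell_affine_independent[OF that] by (simp add: affine_independent_iff_card aff_dim_convex_hull)
  have "P \<times> Q \<subseteq> \<Union>{K \<in> (hull) convex ` cells. aff_dim (P \<times> Q) \<le> aff_dim K}"
  proof (rule convex_covered_by_full_dim)
    show "closed K" if "K \<in> (hull) convex ` cells" for K
      using that finite_cell compact_imp_closed finite_imp_compact_convex_hull by blast
  qed (use cells_cover finite_cells conv in auto)
  also have "\<dots> \<subseteq> \<Union>refinement"
  proof
    fix z assume "z \<in> \<Union>{K \<in> (hull) convex ` cells. aff_dim (P \<times> Q) \<le> aff_dim K}"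
    then obtain A where A: "A \<in> cells" "z \<in> convex hull A" "aff_dim (P \<times> Q) \<le> aff_dim (convex hull A)"
      by blast
    \<comment> \<open>The hull of \<open>A\<close> lies in \<open>P \<times> Q\<close>, which gives
      the reverse inequality of dimensions.\<close>
    then have "int (card A) = aff_dim (P \<times> Q) + 1"
      using aff_dim_subset[OF sub[OF A(1)]] dim[OF A(1)] by simp
    then show "z \<in> \<Union>refinement"
      using A by (auto simp: refinement_def)
  qed
  finally have "\<Union>refinement = P \<times> Q"
    using sub by (auto simp: refinement_def)
  moreover have "aff_dim (P \<times> Q) simplex (convex hull A) \<and> vertices (convex hull A) \<subseteq> vertices (P \<times> Q)"
    if "A \<in> ?M" for A
    using that cell_affine_independent[of A] cells_subset[of A]
    by (auto simp: simplex_convex_hull vertices_convex_hull vertices_Times)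
  ultimately show ?thesis
    using tri by (auto simp: triangulation_of_def refinement_def)
qed

text \<open>A union bound over the pairs of simplices. A full-dimensional cell has
  \<open>l + n\<close> vertices, which is the maximum for every pair: the types add up to
  \<open>l\<close> and the colour classes to \<open>n\<close>.\<close>

lemma card_refinement_le:
  assumes P: "aff_dim P = int l" and Q: "aff_dim Q = int n - 1" and n: "0 < n"
    and k: "k = int m - 1" and m: "0 < m"
  shows "real (card refinement) \<le> (\<Sum>S\<in>TQ. \<Sum>R\<in>T0. weight D R *
    (\<Prod>v\<in>C. pochhammer (real (card {w \<in> vertices S. c w = v})) (simplex_type R v)))"
proof -
  have Dne: "D \<noteq> {}" and aD: "aff_dim D = int m - 1"
    using k m aff_dim_simplex[OF simD] by auto
  have Pne: "P \<noteq> {}"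
    using P by auto
  have cS: "card (vertices S) = n" if "S \<in> TQ" for S
    using simplexD(3)[of "aff_dim Q" S] TQ that Q by (auto simp: triangulation_of_def)
  have R: "aff_dim (P \<times> D) simplex R" "vertices R \<subseteq> vertices (P \<times> D)" if "R \<in> T0" for R
    using T0 that by (auto simp: triangulation_of_def)
  note fullR = full_simplex_Times[OF P simD[unfolded k] m R]
  have sum_TQ: "(\<Sum>v\<in>C. card {w \<in> vertices S. c w = v}) = n" if S: "S \<in> TQ" for S
  proof -
    have "(\<Sum>v\<in>C. \<Sum>w | w \<in> vertices S \<and> c w = v. 1) = (\<Sum>w\<in>vertices S. 1::nat)"
      by (rule sum.group) (use vertices_TQ[OF S] finite_vertices_TQ[OF S] finC c in auto)
    then show ?thesis
      using cS[OF S] by simp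
  qed
  let ?St = "\<lambda>S R. {A \<in> staircases f g c (vertices R) (vertices S). card A = l + n}"
  have "Q \<noteq> {}"
    using Q n by auto
  from aff_dim_Times[OF Pne this] have dim: "aff_dim (P \<times> Q) + 1 = int (l + n)"
    using P Q by simp
  have fin: "finite TQ" "finite T0"
    using T0 TQ by (auto simp: triangulation_of_def triangulation_def)
  have "card refinement \<le> card {A \<in> cells. int (card A) = int (l + n)}"
    unfolding refinement_def dim using finite_cells by (intro card_image_le) simp
  also have "{A \<in> cells. int (card A) = int (l + n)} = (\<Union>S\<in>TQ. \<Union>R\<in>T0. ?St S R)"
    unfolding cells_def of_nat_eq_iff by blast
  also have "card \<dots> \<le> (\<Sum>S\<in>TQ. card (\<Union>R\<in>T0. ?St S R))"
    by (rule card_UN_le[OF fin(1)])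
  also have "\<dots> \<le> (\<Sum>S\<in>TQ. \<Sum>R\<in>T0. card (?St S R))"
    by (intro sum_mono card_UN_le fin)
  finally have "real (card refinement) \<le> real (\<Sum>S\<in>TQ. \<Sum>R\<in>T0. card (?St S R))"
    by (simp only: of_nat_le_iff)
  also have "\<dots> = (\<Sum>S\<in>TQ. \<Sum>R\<in>T0. real (card (?St S R)))"
    by simp
  also have "\<dots> \<le> (\<Sum>S\<in>TQ. \<Sum>R\<in>T0. weight D R *
    (\<Prod>v\<in>C. pochhammer (real (card {w \<in> vertices S. c w = v})) (simplex_type R v)))"
  proof (intro sum_mono)
    fix S R assume SR: "S \<in> TQ" "R \<in> T0"
    have "real (card (?St S R)) \<le>
      (\<Prod>v\<in>C. pochhammer (real (card {w \<in> vertices S. c w = v})) (simplex_type R v)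
        / fact (simplex_type R v))"
      unfolding simplex_type_eq
    proof (rule card_staircases_le)
      show "l + n = (\<Sum>v\<in>C. card {x. (x, v) \<in> vertices R} - 1 + card {w \<in> vertices S. c w = v})"
        using fullR(2)[OF SR(2) SR(2)] sum_TQ[OF SR(1)] by (simp add: sum.distrib simplex_type_eq)
      show "inj_on f (fst ` vertices R)"
        by (rule inj_on_subset[OF f]) (use vertices_T0[OF SR(2)] in auto)
      show "inj_on g (vertices S)"
        using g vertices_TQ[OF SR(1)] by (rule inj_on_subset)
      show "c ` vertices S \<subseteq> C"
        using c vertices_TQ[OF SR(1)] by auto
    qed (use SR fullR(1) finite_vertices_T0 finite_vertices_TQ finC in auto)
    also have "\<dots> = weight D R *
      (\<Prod>v\<in>C. pochhammer (real (card {w \<in> vertices S. c w = v})) (simplex_type R v))"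
      by (simp add: weight_def prod_dividef)
    finally show "real (card (?St S R)) \<le> weight D R *
      (\<Prod>v\<in>C. pochhammer (real (card {w \<in> vertices S. c w = v})) (simplex_type R v))" .
  qed
  finally show ?thesis .
qed

end

section \<open>Choice of a colouring by averaging\<close>

theorem theorem2p2:
  fixes P :: "'a::euclidean_space set"
    and Q :: "'b::euclidean_space set"
    and D :: "'c::euclidean_space set"
    and T0 :: "('a \<times> 'c) set set"
    and TQ :: "'b set set"
    and l m n :: nat
    and t0 :: real
  assumes "polytope P" and "aff_dim P = int l"
    and "polytope Q" and "aff_dim Q = int n - 1"
    and "0 < m" and "m \<le> n"
    and "(int m - 1) simplex D"
    and "triangulation_of T0 (P \<times> D)" and "weighted_size D T0 = t0"
    and "triangulation_of TQ Q"
  shows "\<exists>T :: ('a \<times> 'b) set set. triangulation_of T (P \<times> Q) \<and>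
           real (card T) \<le> real (card TQ) * t0 * (real n / real m + real l) ^ l"
proof -
  let ?F = "vertices P" and ?G = "vertices Q" and ?C = "vertices D"
  have fin: "finite ?F" "finite ?G" "finite ?C"
    using assms polytope_vertices simplexD(2) by blast+
  have cC: "card ?C = m"
    using simplexD(3)[OF assms(7)] by simp
  obtain f :: "'a \<Rightarrow> nat" where f: "inj_on f ?F"
    using finite_imp_inj_to_nat_seg[OF fin(1)] by blast
  obtain g :: "'b \<Rightarrow> nat" where g: "inj_on g ?G"
    using finite_imp_inj_to_nat_seg[OF fin(2)] by blast
  define E where "E = (?G \<rightarrow>\<^sub>E ?C)"
  define h where "h S R c =
    (\<Prod>v\<in>?C. pochhammer (real (card {w \<in> vertices S. c w = v})) (simplex_type R v))"
    for S :: "'b set" and R :: "('a \<times> 'c) set" and c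
  define size where "size c = (\<Sum>S\<in>TQ. \<Sum>R\<in>T0. weight D R * h S R c)" for c
  define b where "b = (real n / real m + real l) ^ l"
  have size: "\<exists>T :: ('a \<times> 'b) set set. triangulation_of T (P \<times> Q) \<and> real (card T) \<le> size c"
    if "c \<in> E" for c
  proof -
    interpret coloured_triangulation P Q D T0 TQ "int m - 1" c f g
      using assms f g that by unfold_locales (auto simp: E_def)
    show ?thesis
      using triangulation_of_refinement card_refinement_le[of l n m] assms
      unfolding size_def h_def by (intro exI[of _ refinement]) auto
  qed
  have cE: "card E = m ^ card ?G" "finite E" "E \<noteq> {}"
  proof -
    show "card E = m ^ card ?G"
      unfolding E_def using card_funcsetE[OF fin(2), of ?C] cC by simp
    then have "card E > 0"
      using assms(5) by simp
    then show "finite E" "E \<noteq> {}"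
      using card_gt_0_iff by blast+
  qed
  have h_le: "(\<Sum>c\<in>E. h S R c) \<le> real (card E) * b" if SR: "S \<in> TQ" "R \<in> T0" for S R
  proof -
    have S: "vertices S \<subseteq> ?G" "card (vertices S) = n"
      using assms SR simplexD(3)[of "aff_dim Q" S] by (auto simp: triangulation_of_def)
    have R: "aff_dim (P \<times> D) simplex R" "vertices R \<subseteq> vertices (P \<times> D)"
      using assms SR by (auto simp: triangulation_of_def)
    have sum: "(\<Sum>v\<in>?C. simplex_type R v) = l"
      by (rule full_simplex_Times(2)[OF assms(2,7,5) R])
    \<comment> \<open>The averaging bound with zero constants, counting only the vertices of
      \<open>S\<close> while all vertices of \<open>Q\<close> are coloured.\<close>
    have "(\<Sum>c\<in>E. h S R c) \<le>
        real m ^ card ?G * (\<Prod>v\<in>?C. (real n / real m + 0 + real (simplex_type R v) - 1) ^ simplex_type R v)"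
      using sum_PiE_pochhammer_le[OF fin(2,3) S(1), of "\<lambda>_. 0" "simplex_type R"]
      by (simp add: E_def h_def cC S(2))
    also have "\<dots> \<le> real m ^ card ?G * (\<Prod>v\<in>?C. (real n / real m + real l) ^ simplex_type R v)"
    proof (intro mult_left_mono prod_mono conjI)
      fix v assume v: "v \<in> ?C"
      have le: "simplex_type R v \<le> l"
        using member_le_sum[OF v, of "simplex_type R"] fin(3) sum by simp
      show "0 \<le> (real n / real m + 0 + real (simplex_type R v) - 1) ^ simplex_type R v"
        by (cases "simplex_type R v") auto
      show "(real n / real m + 0 + real (simplex_type R v) - 1) ^ simplex_type R v
          \<le> (real n / real m + real l) ^ simplex_type R v"
        using le by (cases "simplex_type R v") (auto intro!: power_mono simp del: power_Suc)
    qed auto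
    \<comment> \<open>The types are the exponents, and they add up to \<open>l\<close>.\<close>
    also have "\<dots> = real (card E) * b"
      by (simp add: cE b_def sum flip: power_sum)
    finally show ?thesis .
  qed
  have weight: "weight D R \<ge> 0" for R :: "('a \<times> 'c) set"
    by (simp add: weight_def prod_nonneg)
  \<comment> \<open>One colouring must serve all pairs \<open>S\<close>, \<open>R\<close> together,
    so the average is taken of the total \<open>size\<close>; by linearity each pair can be bounded
    separately, and the weights add up to \<open>t0\<close>.\<close>
  have "\<exists>c\<in>E. size c \<le> real (card TQ) * t0 * b"
  proof (rule ccontr)
    assume "\<not> ?thesis"
    then have "(\<Sum>c\<in>E. real (card TQ) * t0 * b) < (\<Sum>c\<in>E. size c)"
      using cE by (intro sum_strict_mono) (auto simp: not_le)
    also have "(\<Sum>c\<in>E. size c) = (\<Sum>S\<in>TQ. \<Sum>R\<in>T0. weight D R * (\<Sum>c\<in>E. h S R c))"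
      unfolding size_def sum_distrib_left
      by (subst sum.swap, intro sum.cong refl, rule sum.swap)
    also have "\<dots> \<le> (\<Sum>S\<in>TQ. \<Sum>R\<in>T0. weight D R * (real (card E) * b))"
      by (intro sum_mono mult_left_mono h_le weight)
    also have "\<dots> = (\<Sum>c\<in>E. real (card TQ) * t0 * b)"
      using assms(9) by (simp add: weighted_size_def flip: sum_distrib_right)
    finally show False by simp
  qed
  then show ?thesis
    using size unfolding b_def by (meson order_trans)
qed

end
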